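(* Let $\sigma\in(0,\infty)$, $\eta\in(1,\infty)$, $n\geqslant1$, and $u_0,u_1,u_2\in L^1(\mathbb{R}^n)$ with $$\int_{\mathbb{R}^n}u_2(x)\,\mathrm{d}x>0.$$ Let $1<p\leqslant p_{\mathrm{crit}}(n,\sigma)$. Then, for every $\epsilon>0$, the semilinear Cauchy problem $(\mathrm{P}_\epsilon)$ admits no global (in time) weak solution, i.e. no weak solution on $[0,\infty)$; every weak solution blows up in finite time.
   Context: For $\sigma>0$ and $\alpha\in[0,1]$, $\mathcal{A}^{\alpha}=(-\Delta)^{\sigma\alpha}$ denotes the Fourier multiplier $\mathcal{A}^{\alpha}u=\mathcal{F}^{-1}(|\xi|^{2\sigma\alpha}\mathcal{F}u)$, $\mathcal{A}=(-\Delta)^\sigma$. The problem $(\mathrm{P}_\epsilon)$ is $u_{ttt}+\mathcal{A}u+\eta\mathcal{A}^{\frac{1}{3}}u_{tt}+\eta\mathcal{A}^{\frac{2}{3}}u_t=|u|^p$ on $(0,\infty)\times\mathbb{R}^n$, with $u(0)=\epsilon u_0$, $u_t(0)=\epsilon u_1$, $u_{tt}(0)=\epsilon u_2$. $p_{\mathrm{crit}}(n,\sigma):=1+\frac{6\sigma}{(3n-4\sigma)_+}$ with $(x)_+=\max\{x,0\}$ and $\frac{1}{(x)_+}=\infty$ if $x\leqslant0$ (so every $p>1$ is allowed if $n\leqslant\frac43\sigma$). A weak solution of $(\mathrm{P}_\epsilon)$ on $[0,T)$ ($T\in(0,\infty]$) is a function $u\in L^p_{\mathrm{loc}}([0,T)\times\mathbb{R}^n)$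 such that for every test function $\Phi$, smooth in $t$, vanishing for $t\geqslant T'$ for some $T'<T$, and with sufficient regularity and decay in $x$ (e.g. $\Phi(t,x)=\langle x/R\rangle^{-n-2s}\zeta(t)$, $s>0$ small, $\zeta$ smooth compactly supported in $[0,T)$) that all integrals converge absolutely, one has $$\int_0^T\!\!\int_{\mathbb{R}^n}|u|^p\Phi\,\mathrm{d}x\mathrm{d}t+\epsilon\int_{\mathbb{R}^n}\Big(u_2\Phi(0)-u_1\partial_t\Phi(0)+u_0\partial_t^2\Phi(0)+\eta u_1\mathcal{A}^{\frac13}\Phi(0)-\eta u_0\mathcal{A}^{\frac13}\partial_t\Phi(0)+\eta u_0\mathcal{A}^{\frac23}\Phi(0)\Big)\mathrm{d}x$$ $$=\int_0^T\!\!\int_{\mathbb{R}^n}u\,\big(-\partial_t^3+\mathcal{A}+\eta\mathcal{A}^{\frac{1}{3}}\partial_t^2-\eta\mathcal{A}^{\frac{2}{3}}\partial_t\big)\Phi\,\mathrm{d}x\mathrm{d}t .$$ *)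

theory Defs
  imports "HOL-Analysis.Analysis"
begin

definition fourier :: "('a::euclidean_space \<Rightarrow> complex) \<Rightarrow> 'a \<Rightarrow> complex" where
  "fourier f \<xi> = (\<integral>x. f x * cis (- (x \<bullet> \<xi>)) \<partial>lborel)"

definition inv_fourier :: "('a::euclidean_space \<Rightarrow> complex) \<Rightarrow> 'a \<Rightarrow> complex" where
  "inv_fourier g x = complex_of_real ((2 * pi) powr (- real DIM('a))) *
      (\<integral>\<xi>. g \<xi> * cis (x \<bullet> \<xi>) \<partial>lborel)"

text \<open>fracA sigma alpha f = F^(-1)(|xi|^(2 sigma alpha) F f), applied to real-valued f;
  the result is real for real f (radial real multiplier), we take the real part.\<close>

definition fracA :: "real \<Rightarrow> real \<Rightarrow> ('a::euclidean_space \<Rightarrow> real) \<Rightarrow> 'a \<Rightarrow> real" where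
  "fracA \<sigma> \<alpha> f x = Re (inv_fourier (\<lambda>\<xi>. complex_of_real (norm \<xi> powr (2 * \<sigma> * \<alpha>)) *
                                    fourier (\<lambda>y. complex_of_real (f y)) \<xi>) x)"

definition p_crit :: "nat \<Rightarrow> real \<Rightarrow> ereal" where
  "p_crit n \<sigma> = (if 3 * real n - 4 * \<sigma> \<le> 0 then \<infinity>
                  else ereal (1 + 6 * \<sigma> / (3 * real n - 4 * \<sigma>)))"

definition smooth_fun :: "(real \<Rightarrow> real) \<Rightarrow> bool" where
  "smooth_fun \<zeta> \<longleftrightarrow> (\<forall>k t. ((deriv ^^ k) \<zeta>) differentiable (at t))"

definition admissible_time :: "ereal \<Rightarrow> (real \<Rightarrow> real) \<Rightarrow> bool" where
  "admissible_time T \<zeta> \<longleftrightarrow> smooth_fun \<zeta> \<and> (\<exists>T'. ereal T' < T \<and> (\<forall>t\<ge>T'. \<zeta> t = 0))"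

definition jbr :: "'a::euclidean_space \<Rightarrow> real" where
  "jbr x = sqrt (1 + (norm x)\<^sup>2)"

definition test_fun :: "real \<Rightarrow> real \<Rightarrow> (real \<Rightarrow> real) \<Rightarrow> real \<Rightarrow> 'a::euclidean_space \<Rightarrow> real" where
  "test_fun s R \<zeta> t x = jbr (x /\<^sub>R R) powr (- (real DIM('a) + 2 * s)) * \<zeta> t"

definition dt :: "nat \<Rightarrow> (real \<Rightarrow> 'a \<Rightarrow> real) \<Rightarrow> real \<Rightarrow> 'a \<Rightarrow> real" where
  "dt k \<Phi> t x = (deriv ^^ k) (\<lambda>\<tau>. \<Phi> \<tau> x) t"

definition Ax :: "real \<Rightarrow> real \<Rightarrow> (real \<Rightarrow> 'a::euclidean_space \<Rightarrow> real) \<Rightarrow> real \<Rightarrow> 'a \<Rightarrow> real" where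
  "Ax \<sigma> \<alpha> \<Phi> t x = fracA \<sigma> \<alpha> (\<lambda>y. \<Phi> t y) x"

definition adj_op :: "real \<Rightarrow> real \<Rightarrow> (real \<Rightarrow> 'a::euclidean_space \<Rightarrow> real) \<Rightarrow> real \<Rightarrow> 'a \<Rightarrow> real" where
  "adj_op \<sigma> \<eta> \<Phi> t x =
     - dt 3 \<Phi> t x + Ax \<sigma> 1 \<Phi> t x + \<eta> * Ax \<sigma> (1/3) (dt 2 \<Phi>) t x
     - \<eta> * Ax \<sigma> (2/3) (dt 1 \<Phi>) t x"

definition data_term :: "real \<Rightarrow> real \<Rightarrow> ('a::euclidean_space \<Rightarrow> real) \<Rightarrow> ('a \<Rightarrow> real) \<Rightarrow> ('a \<Rightarrow> real)
     \<Rightarrow> (real \<Rightarrow> 'a \<Rightarrow> real) \<Rightarrow> 'a \<Rightarrow> real" where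
  "data_term \<sigma> \<eta> u0 u1 u2 \<Phi> x =
     u2 x * \<Phi> 0 x - u1 x * dt 1 \<Phi> 0 x + u0 x * dt 2 \<Phi> 0 x
     + \<eta> * u1 x * Ax \<sigma> (1/3) \<Phi> 0 x - \<eta> * u0 x * Ax \<sigma> (1/3) (dt 1 \<Phi>) 0 x
     + \<eta> * u0 x * Ax \<sigma> (2/3) \<Phi> 0 x"

definition time_slab :: "ereal \<Rightarrow> (real \<times> 'a) set" where
  "time_slab T = {(t, x). 0 \<le> t \<and> ereal t < T}"

definition Lp_loc :: "real \<Rightarrow> ereal \<Rightarrow> (real \<Rightarrow> 'a::euclidean_space \<Rightarrow> real) \<Rightarrow> bool" where
  "Lp_loc p T u \<longleftrightarrow> (\<forall>K. compact K \<and> K \<subseteq> time_slab T \<longrightarrow>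
      set_integrable lborel K (\<lambda>(t, x). \<bar>u t x\<bar> powr p))"

definition weak_solution ::
  "real \<Rightarrow> real \<Rightarrow> real \<Rightarrow> real \<Rightarrow> ('a::euclidean_space \<Rightarrow> real) \<Rightarrow> ('a \<Rightarrow> real) \<Rightarrow> ('a \<Rightarrow> real)
     \<Rightarrow> ereal \<Rightarrow> (real \<Rightarrow> 'a \<Rightarrow> real) \<Rightarrow> bool" where
  "weak_solution \<sigma> \<eta> p \<epsilon> u0 u1 u2 T u \<longleftrightarrow>
     Lp_loc p T u \<and>
     (\<exists>s0>0. \<forall>s R \<zeta>. 0 < s \<and> s < s0 \<and> 0 < R \<and> admissible_time T \<zeta> \<longrightarrow>
        (let \<Phi> = test_fun s R \<zeta> in
           set_integrable lborel (time_slab T) (\<lambda>(t, x). \<bar>u t x\<bar> powr p * \<Phi> t x) \<and>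
           set_integrable lborel (time_slab T) (\<lambda>(t, x). u t x * adj_op \<sigma> \<eta> \<Phi> t x) \<and>
           integrable lborel (data_term \<sigma> \<eta> u0 u1 u2 \<Phi>) \<and>
           set_lebesgue_integral lborel (time_slab T) (\<lambda>(t, x). \<bar>u t x\<bar> powr p * \<Phi> t x)
             + \<epsilon> * (\<integral>x. data_term \<sigma> \<eta> u0 u1 u2 \<Phi> x \<partial>lborel)
           = set_lebesgue_integral lborel (time_slab T) (\<lambda>(t, x). u t x * adj_op \<sigma> \<eta> \<Phi> t x)))"

end

theory Submission
  imports Defs "HOL-Probability.Characteristic_Functions" "HOL-Computational_Algebra.Polynomial"
begin

text \<open>Test with \<open>\<Phi>(t, x) = \<langle>x/R\<rangle>\<^bsup>-n-2s\<^esup> \<psi>(t / R\<^bsup>2\<sigma>/3\<^esup>)\<close>. All four terms of the adjoint operator then scale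
  like \<open>R\<^bsup>-2\<sigma>\<^esup>\<close> and are at most \<open>K R\<^bsup>-2\<sigma>\<^esup> \<langle>x/R\<rangle>\<^bsup>-n-2s\<^esup> \<psi>\<^bsup>1/p\<^esup>\<close>, where \<open>\<psi>\<close> is a cutoff whose derivatives are
  controlled by \<open>\<psi>\<^bsup>1/p\<^esup>\<close>. By Young's inequality the weak identity bounds the integral of \<open>|u|\<^sup>p \<Phi>\<close> uniformly
  in \<open>R\<close>, precisely because \<open>-2\<sigma>p' + n + 2\<sigma>/3 \<le> 0\<close> for \<open>p \<le> p\<^sub>c\<^sub>r\<^sub>i\<^sub>t\<close>; so \<open>u\<close> lies in \<open>L\<^sup>p\<close> globally. For such
  \<open>u\<close> the right-hand side of the identity even tends to 0, also in the critical case, since the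
  majorants above are bounded in \<open>L\<^bsup>p'\<^esup>\<close> and tend to 0 uniformly. Hence \<open>\<epsilon> \<integral> u\<^sub>2 \<le> 0\<close>.

  The decay \<open>|(-\<Delta>)\<^bsup>\<beta>\<^esup> \<langle>x\<rangle>\<^bsup>-n-2s\<^esup>| \<le> C \<langle>x\<rangle>\<^bsup>-n-2s\<^esup>\<close> for \<open>0 < s < \<beta>\<close> is obtained on the Fourier side: both
  \<open>\<langle>x\<rangle>\<^bsup>-n-2s\<^esup>\<close> and the symbol \<open>|\<xi>|\<^bsup>2\<beta>\<^esup>\<close> are Gamma mixtures of Gaussians (the latter times \<open>|\<xi>|\<^bsup>2k\<^esup>\<close>), for
  which the transforms are explicit.\<close>

section \<open>Fourier transforms of Gaussian moments\<close>

lemma borel_measurable_cis [measurable]: "cis \<in> borel_measurable borel"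
  by (intro borel_measurable_continuous_onI) (auto intro: continuous_intros)

text \<open>Rescaling by \<open>c = 1 / sqrt (2 * a)\<close> turns the Gaussian into the standard
  normal density, so the value is read off from its characteristic function.\<close>

lemma gaussian_fourier_real:
  fixes a y :: real
  assumes a: "0 < a"
  shows "integrable lborel (\<lambda>x. complex_of_real (exp (- a * x\<^sup>2)) * cis (x * y))"
    and "(\<integral>x. complex_of_real (exp (- a * x\<^sup>2)) * cis (x * y) \<partial>lborel)
         = complex_of_real (sqrt (pi / a) * exp (- y\<^sup>2 / (4 * a)))"
proof -
  define c where "c = 1 / sqrt (2 * a)"
  have c: "0 < c" "c \<noteq> 0" using a by (auto simp: c_def)
  have c2: "c\<^sup>2 = 1 / (2 * a)" using a by (simp add: c_def power_divide)
  let ?f = "\<lambda>x. complex_of_real (exp (- a * x\<^sup>2)) * cis (x * y)"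
  let ?g = "\<lambda>x. complex_of_real (std_normal_density x) * cis (x * (c * y))"
  have scale: "?f (0 + c * x) = complex_of_real (sqrt (2 * pi)) * ?g x" for x
  proof -
    have "- a * (c * x)\<^sup>2 = - x\<^sup>2 / 2"
      using a by (simp add: power_mult_distrib c2)
    then show ?thesis
      by (simp add: std_normal_density_def mult_ac)
  qed
  have "integrable lborel (\<lambda>x. complex_of_real (std_normal_density x))"
    by simp
  then have int: "integrable lborel ?g"
    by (rule Bochner_Integration.integrable_bound) (auto simp: norm_mult)
  then have "integrable lborel (\<lambda>x. ?f (0 + c * x))"
    unfolding scale by simp
  then show "integrable lborel ?f"
    using c by (subst (asm) lborel_integrable_real_affine_iff) auto
  have "(\<integral>x. ?g x \<partial>lborel) = char std_normal_distribution (c * y)"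
    unfolding char_def
    by (subst integral_density) (auto simp: scaleR_conv_of_real cis_conv_exp mult_ac)
  also have "\<dots> = complex_of_real (exp (- y\<^sup>2 / (4 * a)))"
    using a by (simp add: char_std_normal_distribution power_mult_distrib c2)
  finally have g: "(\<integral>x. ?g x \<partial>lborel) = complex_of_real (exp (- y\<^sup>2 / (4 * a)))" .
  have "(\<integral>x. ?f x \<partial>lborel) = \<bar>c\<bar> *\<^sub>R (\<integral>x. ?f (0 + c * x) \<partial>lborel)"
    using c by (intro lborel_integral_real_affine) auto
  also have "\<dots> = complex_of_real (c * sqrt (2 * pi) * exp (- y\<^sup>2 / (4 * a)))"
    unfolding scale using c g by (simp add: scaleR_conv_of_real)
  also have "c * sqrt (2 * pi) = sqrt (pi / a)"
    using a by (simp add: c_def real_sqrt_divide real_sqrt_mult)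
  finally show "(\<integral>x. ?f x \<partial>lborel) = complex_of_real (sqrt (pi / a) * exp (- y\<^sup>2 / (4 * a)))" .
qed

lemma norm_sq_eq_sum_Basis: "(norm (x::'a::euclidean_space))\<^sup>2 = (\<Sum>b\<in>Basis. (x \<bullet> b)\<^sup>2)"
  by (simp add: norm_eq_sqrt_inner euclidean_inner[of x x] power2_eq_square sum_nonneg)

lemma cis_sum: "cis (\<Sum>i\<in>A. f i) = (\<Prod>i\<in>A. cis (f i))"
  by (induction A rule: infinite_finite_induct) (auto simp: cis_mult[symmetric])

text \<open>Gaussian and phase both factor over the coordinates, which reduces the integral to a
  product of one-dimensional ones.\<close>

lemma gaussian_fourier:
  fixes y :: "'a::euclidean_space"
  assumes a: "0 < a"
  shows "integrable lborel (\<lambda>x. complex_of_real (exp (- a * (norm x)\<^sup>2)) * cis (x \<bullet> y))"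
    and "(\<integral>x. complex_of_real (exp (- a * (norm x)\<^sup>2)) * cis (x \<bullet> y) \<partial>lborel)
         = complex_of_real ((pi / a) powr (DIM('a) / 2) * exp (- (norm y)\<^sup>2 / (4 * a)))"
proof -
  interpret product_sigma_finite "\<lambda>_::'a. lborel :: real measure"
    by unfold_locales
  define f where "f b t = complex_of_real (exp (- a * t\<^sup>2)) * cis (t * (y \<bullet> b))" for b :: 'a and t
  let ?F = "\<lambda>x::'a. complex_of_real (exp (- a * (norm x)\<^sup>2)) * cis (x \<bullet> y)"
  let ?S = "\<lambda>g. \<Sum>b\<in>Basis. g b *\<^sub>R b :: 'a"
  have F: "?F x = (\<Prod>b\<in>Basis. f b (x \<bullet> b))" for x
    unfolding f_def prod.distrib norm_sq_eq_sum_Basis euclidean_inner[of x y] cis_sum sum_distrib_left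
    by (simp add: exp_sum)
  have FS: "?F (?S g) = (\<Prod>b\<in>Basis. f b (g b))" for g
    unfolding F by (intro prod.cong refl) (simp add: inner_sum_left_Basis)
  have fint: "integrable lborel (f b)" for b
    unfolding f_def by (rule gaussian_fourier_real(1)[OF a])
  have "integrable (\<Pi>\<^sub>M b\<in>Basis. lborel) (\<lambda>g. ?F (?S g))"
    unfolding FS by (intro product_integrable_prod fint) auto
  then show "integrable lborel ?F"
    by (subst lborel_eq) (simp add: integrable_distr_eq)
  have "(\<integral>x. ?F x \<partial>lborel) = (\<integral>g. ?F (?S g) \<partial>(\<Pi>\<^sub>M b\<in>Basis. lborel))"
    by (subst lborel_eq) (simp add: integral_distr)
  also have "\<dots> = (\<Prod>b\<in>Basis. \<integral>t. f b t \<partial>lborel)"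
    unfolding FS by (intro product_integral_prod fint) auto
  also have "\<dots> = (\<Prod>b\<in>Basis. complex_of_real (sqrt (pi / a) * exp (- (y \<bullet> b)\<^sup>2 / (4 * a))))"
    unfolding f_def gaussian_fourier_real(2)[OF a] ..
  also have "\<dots> = complex_of_real (sqrt (pi / a) ^ DIM('a) * exp (- (norm y)\<^sup>2 / (4 * a)))"
    unfolding norm_sq_eq_sum_Basis of_real_prod[symmetric] prod.distrib
    by (simp add: exp_sum sum_divide_distrib sum_negf[symmetric])
  also have "sqrt (pi / a) ^ DIM('a) = (pi / a) powr (DIM('a) / 2)"
    using a by (simp add: powr_half_sqrt[symmetric] powr_power)
  finally show "(\<integral>x. ?F x \<partial>lborel)
      = complex_of_real ((pi / a) powr (DIM('a) / 2) * exp (- (norm y)\<^sup>2 / (4 * a)))" .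
qed

section \<open>Decay of Gaussian moments\<close>

text \<open>Raise \<open>z \<le> exp z\<close> with \<open>z = x * \<delta> / \<gamma>\<close> to
  the power \<gamma>; the constant undoes the rescaling. The division forces the separate case
  \<gamma> = 0.\<close>

lemma powr_le_exp:
  fixes \<gamma> \<delta> :: real
  assumes "0 \<le> \<gamma>" "0 < \<delta>"
  obtains C where "0 < C" "\<And>x. 0 < x \<Longrightarrow> x powr \<gamma> \<le> C * exp (\<delta> * x)"
proof (cases "\<gamma> = 0")
  case True
  then show ?thesis
    using assms by (intro that[of 1]) auto
next
  case False
  with assms have g: "0 < \<gamma>" by simp
  show ?thesis
  proof (rule that)
    show "0 < (\<gamma> / \<delta>) powr \<gamma>" using g assms by simp
    fix x :: real assume x: "0 < x"
    have "x * \<delta> / \<gamma> \<le> exp (x * \<delta> / \<gamma>)"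
      using exp_ge_add_one_self[of "x * \<delta> / \<gamma>"] by linarith
    then have "(x * \<delta> / \<gamma>) powr \<gamma> \<le> exp (x * \<delta> / \<gamma>) powr \<gamma>"
      using g x assms by (intro powr_mono2) auto
    also have "\<dots> = exp (\<delta> * x)"
      using g by (simp add: powr_def mult_ac)
    finally have "(\<gamma> / \<delta>) powr \<gamma> * (x * \<delta> / \<gamma>) powr \<gamma> \<le> (\<gamma> / \<delta>) powr \<gamma> * exp (\<delta> * x)"
      by (intro mult_left_mono) auto
    then show "x powr \<gamma> \<le> (\<gamma> / \<delta>) powr \<gamma> * exp (\<delta> * x)"
      using g x assms by (simp add: powr_mult[symmetric])
  qed
qed

text \<open>Induction on the coefficients: the factor \<open>z\<close> brought in by
  \<open>pCons\<close> is absorbed by \<open>(1 + z) powr \<gamma>\<close> at the cost of raising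
  \<gamma> by one, so \<gamma> has to be general in the induction.\<close>

lemma poly_powr_exp_bounded:
  fixes q :: "real poly" and \<gamma> \<delta> :: real
  assumes "0 \<le> \<gamma>" "0 < \<delta>"
  shows "\<exists>C>0. \<forall>z\<ge>0. \<bar>poly q z\<bar> * (1 + z) powr \<gamma> * exp (- \<delta> * z) \<le> C"
  using assms(1)
proof (induction q arbitrary: \<gamma>)
  case 0
  then show ?case by (intro exI[of _ 1]) auto
next
  case (pCons c q)
  obtain C1 where C1: "0 < C1" "\<And>x. 0 < x \<Longrightarrow> x powr \<gamma> \<le> C1 * exp (\<delta> * x)"
    using powr_le_exp[of \<gamma> \<delta>] pCons.prems assms by auto
  obtain C2 where C2: "0 < C2"
    "\<And>z. z \<ge> 0 \<Longrightarrow> \<bar>poly q z\<bar> * (1 + z) powr (\<gamma> + 1) * exp (- \<delta> * z) \<le> C2"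
    using pCons.IH[of "\<gamma> + 1"] pCons.prems by auto
  show ?case
  proof (intro exI[of _ "\<bar>c\<bar> * (C1 * exp \<delta>) + C2"] conjI allI impI)
    show "0 < \<bar>c\<bar> * (C1 * exp \<delta>) + C2" using C1 C2 by (intro add_nonneg_pos) auto
    fix z :: real assume z: "0 \<le> z"
    have "(1 + z) powr \<gamma> * exp (- \<delta> * z) \<le> C1 * exp (\<delta> * (1 + z)) * exp (- \<delta> * z)"
      using C1(2)[of "1 + z"] z by (intro mult_right_mono) auto
    also have "\<dots> = C1 * exp \<delta>" by (simp add: algebra_simps exp_add[symmetric])
    finally have 1: "(1 + z) powr \<gamma> * exp (- \<delta> * z) \<le> C1 * exp \<delta>" .
    have "z * (1 + z) powr \<gamma> \<le> (1 + z) powr (\<gamma> + 1)"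
      using z by (simp add: powr_add mult.commute mult_right_mono)
    then have "\<bar>poly q z\<bar> * exp (- \<delta> * z) * (z * (1 + z) powr \<gamma>)
        \<le> \<bar>poly q z\<bar> * exp (- \<delta> * z) * (1 + z) powr (\<gamma> + 1)"
      by (intro mult_left_mono) auto
    also have "\<dots> \<le> C2"
      using C2(2)[OF z] by (simp add: mult_ac)
    finally have 2: "\<bar>poly q z\<bar> * exp (- \<delta> * z) * (z * (1 + z) powr \<gamma>) \<le> C2" .
    have "\<bar>poly (pCons c q) z\<bar> \<le> \<bar>c\<bar> + z * \<bar>poly q z\<bar>"
      using z abs_triangle_ineq[of c "z * poly q z"] by (simp add: abs_mult)
    then have "\<bar>poly (pCons c q) z\<bar> * ((1 + z) powr \<gamma> * exp (- \<delta> * z))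
        \<le> (\<bar>c\<bar> + z * \<bar>poly q z\<bar>) * ((1 + z) powr \<gamma> * exp (- \<delta> * z))"
      by (intro mult_right_mono) auto
    also have "\<dots> = \<bar>c\<bar> * ((1 + z) powr \<gamma> * exp (- \<delta> * z))
        + \<bar>poly q z\<bar> * exp (- \<delta> * z) * (z * (1 + z) powr \<gamma>)"
      by (simp add: algebra_simps)
    also have "\<dots> \<le> \<bar>c\<bar> * (C1 * exp \<delta>) + C2"
      using 1 2 by (intro add_mono mult_left_mono) auto
    finally show "\<bar>poly (pCons c q) z\<bar> * (1 + z) powr \<gamma> * exp (- \<delta> * z) \<le> \<bar>c\<bar> * (C1 * exp \<delta>) + C2"
      by (simp add: mult.assoc)
  qed
qed

text \<open>Up to normalisation, the inverse Fourier transform of a Gaussian times an even power of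
  the norm; the sine part would vanish by symmetry.\<close>

definition gauss_moment :: "nat \<Rightarrow> real \<Rightarrow> 'a::euclidean_space \<Rightarrow> real" where
  "gauss_moment k a x = (\<integral>\<xi>. (norm \<xi>) ^ (2 * k) * exp (- a * (norm \<xi>)\<^sup>2) * cos (x \<bullet> \<xi>) \<partial>lborel)"

lemma integrable_gaussian:
  assumes "0 < a"
  shows "integrable lborel (\<lambda>x::'a::euclidean_space. exp (- a * (norm x)\<^sup>2))"
proof -
  have "integrable lborel (\<lambda>x::'a. Re (complex_of_real (exp (- a * (norm x)\<^sup>2)) * cis (x \<bullet> 0)))"
    by (intro integrable_Re gaussian_fourier(1) assms)
  then show ?thesis by simp
qed

text \<open>Half of the exponential absorbs the power of the norm; the other half is an integrable
  Gaussian.\<close>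

lemma integrable_gauss_moment:
  fixes x :: "'a::euclidean_space"
  assumes a: "0 < a"
  shows "integrable lborel (\<lambda>\<xi>::'a. (norm \<xi>) ^ (2 * k) * exp (- a * (norm \<xi>)\<^sup>2))"
    and "integrable lborel (\<lambda>\<xi>. (norm \<xi>) ^ (2 * k) * exp (- a * (norm \<xi>)\<^sup>2) * cos (x \<bullet> \<xi>))"
proof -
  obtain C where C: "0 < C"
    "\<And>z. z \<ge> 0 \<Longrightarrow> \<bar>poly (monom 1 k) z\<bar> * (1 + z) powr 0 * exp (- (a / 2) * z) \<le> C"
    using poly_powr_exp_bounded[of 0 "a / 2" "monom 1 k"] a by auto
  have b: "norm ((norm \<xi>) ^ (2 * k) * exp (- a * (norm \<xi>)\<^sup>2)) \<le> C * exp (- (a / 2) * (norm \<xi>)\<^sup>2)"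
    for \<xi> :: 'a
  proof -
    let ?z = "(norm \<xi>)\<^sup>2"
    have "?z ^ k * exp (- (a / 2) * ?z) * exp (- (a / 2) * ?z) \<le> C * exp (- (a / 2) * ?z)"
      using C(2)[of ?z] by (intro mult_right_mono) (auto simp: poly_monom add_nonneg_eq_0_iff)
    then show ?thesis by (simp add: power_mult mult.assoc exp_add[symmetric])
  qed
  show *: "integrable lborel (\<lambda>\<xi>::'a. (norm \<xi>) ^ (2 * k) * exp (- a * (norm \<xi>)\<^sup>2))"
  proof (rule Bochner_Integration.integrable_bound)
    show "integrable lborel (\<lambda>\<xi>::'a. C * exp (- (a / 2) * (norm \<xi>)\<^sup>2))"
      using a by (intro integrable_mult_right integrable_gaussian) simp
    show "AE \<xi>::'a in lborel. norm ((norm \<xi>) ^ (2 * k) * exp (- a * (norm \<xi>)\<^sup>2))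
        \<le> norm (C * exp (- (a / 2) * (norm \<xi>)\<^sup>2))"
      using b C(1) by (simp add: abs_mult)
  qed simp
  show "integrable lborel (\<lambda>\<xi>. (norm \<xi>) ^ (2 * k) * exp (- a * (norm \<xi>)\<^sup>2) * cos (x \<bullet> \<xi>))"
    by (rule Bochner_Integration.integrable_bound[OF *]) (auto simp: abs_mult mult_left_le)
qed

lemma gauss_moment_0:
  fixes x :: "'a::euclidean_space"
  assumes a: "0 < a"
  shows "gauss_moment 0 a x = (pi / a) powr (DIM('a) / 2) * exp (- (norm x)\<^sup>2 / (4 * a))"
proof -
  have "gauss_moment 0 a x
      = (\<integral>\<xi>. Re (complex_of_real (exp (- a * (norm \<xi>)\<^sup>2)) * cis (\<xi> \<bullet> x)) \<partial>lborel)"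
    by (simp add: gauss_moment_def inner_commute)
  also have "\<dots> = Re (\<integral>\<xi>. complex_of_real (exp (- a * (norm \<xi>)\<^sup>2)) * cis (\<xi> \<bullet> x) \<partial>lborel)"
    by (intro integral_Re gaussian_fourier(1) a)
  finally show ?thesis
    by (simp only: gaussian_fourier(2)[OF a] Re_complex_of_real)
qed

text \<open>The inequality \<open>1 + x \<le> exp x\<close>, used at \<open>x\<close> and at
  \<open>- x\<close>, encloses the remainder between 0 and \<open>x * (exp x - 1)\<close>.\<close>

lemma exp_remainder_bound:
  fixes x :: real
  shows "\<bar>exp x - 1 - x\<bar> \<le> x\<^sup>2 * exp \<bar>x\<bar>"
proof -
  have 1: "1 + x \<le> exp x" by (rule exp_ge_add_one_self)
  have "(1 - x) * exp x \<le> exp (- x) * exp x"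
    using exp_ge_add_one_self[of "- x"] by (intro mult_right_mono) auto
  then have 2: "exp x - 1 \<le> x * exp x"
    by (simp add: exp_minus algebra_simps)
  have "x * (exp x - 1) \<le> x\<^sup>2 * exp \<bar>x\<bar>"
  proof (cases "0 \<le> x")
    case True
    then have "x * (exp x - 1) \<le> x * (x * exp x)" by (intro mult_left_mono 2)
    with True show ?thesis by (simp add: power2_eq_square)
  next
    case False
    have "(- x) * (1 - exp x) \<le> (- x) * (- x)" by (intro mult_left_mono) (use 1 False in linarith)+
    also have "\<dots> \<le> x\<^sup>2 * exp \<bar>x\<bar>"
      using False by (simp add: power2_eq_square zero_le_mult_iff)
    finally show ?thesis by (simp add: algebra_simps)
  qed
  with 1 2 show ?thesis by (simp add: algebra_simps)
qed

text \<open>Suits derivatives whose remainder can be estimated directly: under the integral in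
  \<open>DERIV_gauss_moment\<close> and at the flat point in \<open>DERIV_flat\<close>.\<close>

lemma has_real_derivative_quadratic_remainder:
  fixes f :: "real \<Rightarrow> real"
  assumes d: "0 < d" and b: "\<And>h. \<bar>h\<bar> \<le> d \<Longrightarrow> \<bar>f (a + h) - f a - h * D\<bar> \<le> C * h\<^sup>2"
  shows "(f has_real_derivative D) (at a)"
  unfolding DERIV_def
proof (rule LIM_zero_cancel, rule tendsto_rabs_zero_cancel, rule tendsto_sandwich)
  show "((\<lambda>_. 0) \<longlongrightarrow> (0::real)) (at (0::real))" by simp
  show "\<forall>\<^sub>F h in at 0. 0 \<le> \<bar>(f (a + h) - f a) / h - D\<bar>" by simp
  show "((\<lambda>h. C * \<bar>h\<bar>) \<longlongrightarrow> 0) (at 0)" by (auto intro!: tendsto_eq_intros)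
  have "\<bar>(f (a + h) - f a) / h - D\<bar> \<le> C * \<bar>h\<bar>" if "h \<noteq> 0" "\<bar>h\<bar> \<le> d" for h
  proof -
    have "\<bar>(f (a + h) - f a) / h - D\<bar> = \<bar>f (a + h) - f a - h * D\<bar> / \<bar>h\<bar>"
      using that by (simp add: abs_divide[symmetric] diff_divide_distrib)
    also have "\<dots> \<le> C * h\<^sup>2 / \<bar>h\<bar>"
      using b[OF that(2)] by (intro divide_right_mono) auto
    also have "\<dots> = C * \<bar>h\<bar>"
      using that by (simp add: power2_eq_square field_simps abs_if)
    finally show ?thesis .
  qed
  then show "\<forall>\<^sub>F h in at 0. \<bar>(f (a + h) - f a) / h - D\<bar> \<le> C * \<bar>h\<bar>"
    using d by (auto simp: eventually_at intro!: exI[of _ d])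
qed

text \<open>Differentiation under the integral sign. For increments of size at most
  \<open>a / 2\<close>, the second-order remainder of the exponential costs at most half of the
  Gaussian decay, so the integrand of the moment of order \<open>k + 2\<close> at
  \<open>a / 2\<close> is a majorant; \<open>C\<close> is its integral.\<close>

lemma DERIV_gauss_moment:
  fixes x :: "'a::euclidean_space"
  assumes a: "0 < a"
  shows "((\<lambda>a. gauss_moment k a x) has_real_derivative - gauss_moment (Suc k) a x) (at a)"
proof -
  let ?f = "\<lambda>k a \<xi>::'a. (norm \<xi>) ^ (2 * k) * exp (- a * (norm \<xi>)\<^sup>2)"
  define C where "C = (\<integral>\<xi>. ?f (Suc (Suc k)) (a / 2) \<xi> \<partial>lborel)"
  show ?thesis
  proof (rule has_real_derivative_quadratic_remainder[where d = "a / 2" and C = C])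
    show "0 < a / 2" using a by simp
    fix h :: real assume h: "\<bar>h\<bar> \<le> a / 2"
    then have ah: "0 < a + h" using a by linarith
    let ?F = "\<lambda>\<xi>. (?f k (a + h) \<xi> * cos (x \<bullet> \<xi>) - ?f k a \<xi> * cos (x \<bullet> \<xi>))
        + h * (?f (Suc k) a \<xi> * cos (x \<bullet> \<xi>))"
    have eq: "gauss_moment k (a + h) x - gauss_moment k a x - h * - gauss_moment (Suc k) a x
        = (\<integral>\<xi>. ?F \<xi> \<partial>lborel)"
      unfolding gauss_moment_def
      by (subst Bochner_Integration.integral_add Bochner_Integration.integral_diff,
          (intro Bochner_Integration.integrable_diff integrable_mult_right integrable_gauss_moment a ah)+)+
        simp
    have "\<bar>\<integral>\<xi>. ?F \<xi> \<partial>lborel\<bar> \<le> (\<integral>\<xi>. h\<^sup>2 * ?f (Suc (Suc k)) (a / 2) \<xi> \<partial>lborel)"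
    proof (rule integral_abs_bound_integral)
      show "integrable lborel ?F"
        by (intro Bochner_Integration.integrable_add Bochner_Integration.integrable_diff
            integrable_mult_right integrable_gauss_moment a ah)
      show "integrable lborel (\<lambda>\<xi>. h\<^sup>2 * ?f (Suc (Suc k)) (a / 2) \<xi>)"
        using a by (intro integrable_mult_right integrable_gauss_moment) simp
      fix \<xi> :: 'a
      define r where "r = (norm \<xi>)\<^sup>2"
      have r: "0 \<le> r" by (simp add: r_def)
      have "?F \<xi> = r ^ k * exp (- a * r) * cos (x \<bullet> \<xi>) * (exp (- h * r) - 1 - (- h * r))"
      proof -
        have e: "exp (- (a + h) * r) = exp (- a * r) * exp (- h * r)"
          by (simp add: exp_add[symmetric] algebra_simps)
        have "r ^ k * (u * v) * c - r ^ k * u * c + h * (r ^ Suc k * u * c)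
            = r ^ k * u * c * (v - 1 - (- h * r))" for u v c
          by (simp add: algebra_simps)
        then show ?thesis
          unfolding power_mult r_def[symmetric] e .
      qed
      then have "\<bar>?F \<xi>\<bar> = r ^ k * exp (- a * r) * \<bar>cos (x \<bullet> \<xi>)\<bar> * \<bar>exp (- h * r) - 1 - (- h * r)\<bar>"
        using r by (simp add: abs_mult)
      also have "\<dots> \<le> r ^ k * exp (- a * r) * 1 * ((- h * r)\<^sup>2 * exp \<bar>- h * r\<bar>)"
        using r by (intro mult_mono exp_remainder_bound) auto
      also have "\<dots> = h\<^sup>2 * (r ^ Suc (Suc k) * exp (- a * r + \<bar>h\<bar> * r))"
        using r by (simp add: power_mult_distrib abs_mult exp_add exp_diff exp_minus power2_eq_square field_simps)
      also have "\<dots> \<le> h\<^sup>2 * (r ^ Suc (Suc k) * exp (- (a / 2) * r))"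
        using r mult_right_mono[OF h r] by (intro mult_left_mono) auto
      finally show "\<bar>?F \<xi>\<bar> \<le> h\<^sup>2 * ?f (Suc (Suc k)) (a / 2) \<xi>"
        by (simp only: r_def power_mult)
    qed
    also have "\<dots> = C * h\<^sup>2"
      unfolding C_def by (subst integral_mult_right_zero) (rule mult.commute)
    finally show "\<bar>gauss_moment k (a + h) x - gauss_moment k a x - h * - gauss_moment (Suc k) a x\<bar> \<le> C * h\<^sup>2"
      unfolding eq .
  qed
qed

text \<open>The form is stable under differentiation in \<open>a\<close>, which up to sign raises
  \<open>k\<close> by one; the explicit Gaussian transform starts the induction.\<close>

lemma gauss_moment_eq_poly:
  "\<exists>q. \<forall>a>0. \<forall>x::'a::euclidean_space. gauss_moment k a x
     = a powr (- (DIM('a) / 2 + k)) * poly q ((norm x)\<^sup>2 / a) * exp (- (1 / 4) * ((norm x)\<^sup>2 / a))"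
proof (induction k)
  case 0
  show ?case
    by (intro exI[of _ "[:pi powr (DIM('a) / 2):]"])
      (auto simp: gauss_moment_0 powr_divide powr_minus field_simps)
next
  case (Suc k)
  define m where "m = DIM('a) / 2 + k"
  from Suc obtain q where q: "\<And>a x. 0 < a \<Longrightarrow> gauss_moment k a (x::'a)
     = a powr (- m) * poly q ((norm x)\<^sup>2 / a) * exp (- (1 / 4) * ((norm x)\<^sup>2 / a))"
    unfolding m_def by blast
  \<comment> \<open>With \<open>z = r / a\<close>, the derivative in \<open>a\<close> of
    \<open>a^(-m) q(z) exp (-z/4)\<close> is
    \<open>- a^(-m-1) (m q(z) + z (dq/dz)(z) - z q(z) / 4) exp (-z/4)\<close>; the bracket is this
    polynomial.\<close>
  define q' where "q' = smult m q + pCons 0 (pderiv q) - smult (1 / 4) (pCons 0 q)"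
  have "gauss_moment (Suc k) a x
     = a powr (- (m + 1)) * poly q' ((norm x)\<^sup>2 / a) * exp (- (1 / 4) * ((norm x)\<^sup>2 / a))"
    if a: "0 < a" for a and x :: 'a
  proof -
    define r where "r = (norm x)\<^sup>2"
    let ?F = "\<lambda>a. a powr (- m) * poly q (r / a) * exp (- (1 / 4) * (r / a))"
    have "(?F has_real_derivative - (a powr (- (m + 1)) * poly q' (r / a) * exp (- (1 / 4) * (r / a)))) (at a)"
    proof -
      have d1: "((\<lambda>a. r / a) has_real_derivative - r / a\<^sup>2) (at a)"
        using a by (auto intro!: derivative_eq_intros simp: power2_eq_square)
      have d2: "((\<lambda>a. poly q (r / a)) has_real_derivative poly (pderiv q) (r / a) * (- r / a\<^sup>2)) (at a)"
        by (rule DERIV_chain2[OF poly_DERIV d1])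
      have d3: "((\<lambda>a. exp (- (1 / 4) * (r / a))) has_real_derivative
          exp (- (1 / 4) * (r / a)) * (- (1 / 4) * (- r / a\<^sup>2))) (at a)"
        by (intro DERIV_chain2[OF DERIV_exp] DERIV_cmult d1)
      have d4: "((\<lambda>a. a powr (- m)) has_real_derivative - m * a powr (- m - 1)) (at a)"
        using has_real_derivative_powr[OF a, of "- m"] by simp
      define E where "E = exp (- (1 / 4) * (r / a))"
      have e: "a powr (- m - 1) = a powr (- (m + 1))" "a powr (- m) = a * a powr (- (m + 1))"
        using a by (simp_all add: powr_diff powr_minus powr_add field_simps)
      show ?thesis
        by (rule DERIV_cong[OF DERIV_mult[OF DERIV_mult[OF d4 d2] d3]])
          (use a in \<open>simp add: e(2) q'_def flip: E_def, simp add: e(1) field_simps power2_eq_square\<close>)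
    qed
    moreover have "(?F has_real_derivative - gauss_moment (Suc k) a x) (at a)"
    proof (rule has_field_derivative_transform_within_open[OF DERIV_gauss_moment[OF a]])
      show "open {0::real<..}" "a \<in> {0<..}" using a by auto
      show "gauss_moment k b x = ?F b" if "b \<in> {0<..}" for b
        using that q by (auto simp: r_def)
    qed
    ultimately show ?thesis
      using DERIV_unique unfolding r_def by fastforce
  qed
  then show ?case
    unfolding m_def by (intro exI[of _ q']) (auto simp: add_ac)
qed

text \<open>The Gaussian factor is traded for polynomial decay of any prescribed order in the
  scale-invariant variable \<open>|x|^2 / a\<close>. The constant does not depend on
  \<open>a\<close>, so the bound can be integrated over mixtures.\<close>

lemma gauss_moment_bound:
  assumes "0 \<le> \<gamma>"
  shows "\<exists>C>0. \<forall>a>0. \<forall>x::'a::euclidean_space. \<bar>gauss_moment k a x\<bar>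
     \<le> C * a powr (- (DIM('a) / 2 + k)) * (1 + (norm x)\<^sup>2 / a) powr (- \<gamma>)"
proof -
  obtain q where q: "\<And>a x. 0 < a \<Longrightarrow> gauss_moment k a (x::'a)
     = a powr (- (DIM('a) / 2 + k)) * poly q ((norm x)\<^sup>2 / a) * exp (- (1 / 4) * ((norm x)\<^sup>2 / a))"
    using gauss_moment_eq_poly by blast
  obtain C where C: "0 < C"
    "\<And>z. z \<ge> 0 \<Longrightarrow> \<bar>poly q z\<bar> * (1 + z) powr \<gamma> * exp (- (1/4) * z) \<le> C"
    using poly_powr_exp_bounded[of \<gamma> "1/4" q] assms by auto
  show ?thesis
  proof (intro exI[of _ C] conjI allI impI C(1))
    fix a :: real and x :: 'a assume a: "0 < a"
    define z where "z = (norm x)\<^sup>2 / a"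
    have z: "0 \<le> z" using a by (simp add: z_def)
    have "\<bar>poly q z\<bar> * exp (- (1/4) * z)
        = (\<bar>poly q z\<bar> * (1 + z) powr \<gamma> * exp (- (1/4) * z)) * (1 + z) powr (- \<gamma>)"
      using z by (simp add: powr_minus)
    also have "\<dots> \<le> C * (1 + z) powr (- \<gamma>)"
      using C(2)[OF z] by (intro mult_right_mono) auto
    finally have "a powr (- (DIM('a) / 2 + k)) * (\<bar>poly q z\<bar> * exp (- (1/4) * z))
        \<le> a powr (- (DIM('a) / 2 + k)) * (C * (1 + z) powr (- \<gamma>))"
      by (intro mult_left_mono) auto
    then show "\<bar>gauss_moment k a x\<bar>
        \<le> C * a powr (- (DIM('a) / 2 + k)) * (1 + (norm x)\<^sup>2 / a) powr (- \<gamma>)"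
      unfolding q[OF a] z_def[symmetric] by (simp add: abs_mult mult_ac)
  qed
qed

section \<open>Fractional Laplacians of powers of the Japanese bracket\<close>

text \<open>Euler's integral after the substitution of \<open>a * t\<close> for \<open>t\<close>.
  The version with values in \<open>ennreal\<close> serves the Tonelli argument in
  \<open>Beta_type_integral\<close>.\<close>

lemma Gamma_integral_scaled:
  fixes s a :: real
  assumes s: "0 < s" and a: "0 < a"
  shows "(\<integral>\<^sup>+t. ennreal (indicator {0<..} t * t powr (s - 1) * exp (- a * t)) \<partial>lborel)
      = ennreal (Gamma s * a powr (- s))"
    and "integrable lborel (\<lambda>t. indicator {0<..} t * t powr (s - 1) * exp (- a * t))"
    and "(\<integral>t. indicator {0<..} t * t powr (s - 1) * exp (- a * t) \<partial>lborel) = Gamma s * a powr (- s)"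
proof -
  let ?g = "\<lambda>t. indicator {0<..} t * t powr (s - 1) * exp (- a * t)"
  have "ennreal (Gamma s) = (\<integral>\<^sup>+t. ennreal (indicator {0..} t * t powr (s - 1) / exp t) \<partial>lborel)"
    by (rule Gamma_conv_nn_integral_real[OF s])
  also have "\<dots> = ennreal \<bar>a\<bar> *
      (\<integral>\<^sup>+t. ennreal (indicator {0..} (0 + a * t) * (0 + a * t) powr (s - 1) / exp (0 + a * t)) \<partial>lborel)"
    using a by (intro nn_integral_real_affine) auto
  also have "(\<lambda>t. indicator {0..} (0 + a * t) * (0 + a * t) powr (s - 1) / exp (0 + a * t))
      = (\<lambda>t. a powr (s - 1) * ?g t)"
    using a by (auto simp: fun_eq_iff indicator_def zero_le_mult_iff powr_mult exp_minus field_simps)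
  also have "(\<integral>\<^sup>+t. ennreal (a powr (s - 1) * ?g t) \<partial>lborel)
      = ennreal (a powr (s - 1)) * (\<integral>\<^sup>+t. ennreal (?g t) \<partial>lborel)"
    by (subst nn_integral_cmult[symmetric]) (auto simp: ennreal_mult'')
  also have "ennreal \<bar>a\<bar> * (ennreal (a powr (s - 1)) * (\<integral>\<^sup>+t. ennreal (?g t) \<partial>lborel))
      = ennreal (a powr s) * (\<integral>\<^sup>+t. ennreal (?g t) \<partial>lborel)"
    using a by (simp add: mult.assoc[symmetric] ennreal_mult'[symmetric] powr_diff)
  finally have eq: "ennreal (Gamma s) = ennreal (a powr s) * (\<integral>\<^sup>+t. ennreal (?g t) \<partial>lborel)" .
  have "ennreal (a powr (- s)) * ennreal (Gamma s) = (\<integral>\<^sup>+t. ennreal (?g t) \<partial>lborel)"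
    using a unfolding eq by (simp add: mult.assoc[symmetric] ennreal_mult'[symmetric] powr_add[symmetric])
  then show *: "(\<integral>\<^sup>+t. ennreal (?g t) \<partial>lborel) = ennreal (Gamma s * a powr (- s))"
    using s by (simp add: ennreal_mult'[symmetric] Gamma_real_pos less_imp_le mult.commute[of "Gamma s"])
  have G: "0 \<le> Gamma s * a powr (- s)" using s by (simp add: Gamma_real_pos less_imp_le)
  have "integrable lborel ?g \<and> (\<integral>t. ?g t \<partial>lborel) = Gamma s * a powr (- s)"
    by (rule nn_integral_eq_integrable[THEN iffD1, OF _ _ G *]) auto
  then show "integrable lborel ?g" "(\<integral>t. ?g t \<partial>lborel) = Gamma s * a powr (- s)" by auto
qed

text \<open>Writing \<open>(t + b) powr (- \<mu>)\<close> as a Gamma integral over \<open>u\<close>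
  and integrating over \<open>t\<close> first leaves two Gamma integrals; \<kappa> < \<mu> makes the
  second one converge.\<close>

lemma Beta_type_integral:
  fixes \<kappa> \<mu> b :: real
  assumes \<kappa>: "0 < \<kappa>" "\<kappa> < \<mu>" and b: "0 < b"
  shows "integrable lborel (\<lambda>t. indicator {0<..} t * t powr (\<kappa> - 1) * (t + b) powr (- \<mu>))"
    and "(\<integral>t. indicator {0<..} t * t powr (\<kappa> - 1) * (t + b) powr (- \<mu>) \<partial>lborel)
      = Gamma \<kappa> * Gamma (\<mu> - \<kappa>) / Gamma \<mu> * b powr (\<kappa> - \<mu>)"
proof -
  let ?g = "\<lambda>t. indicator {0<..} t * t powr (\<kappa> - 1) * (t + b) powr (- \<mu>)"
  let ?h = "\<lambda>t u. indicator {0<..} t * t powr (\<kappa> - 1) * exp (- u * t) *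
      (indicator {0<..} u * u powr (\<mu> - 1) * exp (- b * u)) :: real"
  have \<mu>: "0 < \<mu>" using \<kappa> by simp
  have G: "0 < Gamma \<kappa>" "0 < Gamma \<mu>" "0 < Gamma (\<mu> - \<kappa>)"
    using \<kappa> by (auto intro: Gamma_real_pos)
  have inner: "(\<integral>\<^sup>+u. ennreal (?h t u) \<partial>lborel) = ennreal (Gamma \<mu> * ?g t)" for t
  proof (cases "0 < t")
    case True
    have "(\<integral>\<^sup>+u. ennreal (?h t u) \<partial>lborel)
        = (\<integral>\<^sup>+u. ennreal (t powr (\<kappa> - 1)) *
            ennreal (indicator {0<..} u * u powr (\<mu> - 1) * exp (- (t + b) * u)) \<partial>lborel)"
      using True by (intro nn_integral_cong)
        (simp add: ennreal_mult'[symmetric] exp_diff exp_minus exp_add field_simps)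
    also have "\<dots> = ennreal (t powr (\<kappa> - 1)) * ennreal (Gamma \<mu> * (t + b) powr (- \<mu>))"
      using True b \<mu> by (subst nn_integral_cmult) (auto simp only: Gamma_integral_scaled(1), auto)
    finally show ?thesis
      using True by (simp add: ennreal_mult'[symmetric] mult_ac)
  qed simp
  have "ennreal (Gamma \<mu>) * (\<integral>\<^sup>+t. ennreal (?g t) \<partial>lborel) = (\<integral>\<^sup>+t. ennreal (Gamma \<mu> * ?g t) \<partial>lborel)"
    using G by (subst nn_integral_cmult[symmetric]) (auto simp: ennreal_mult')
  also have "\<dots> = (\<integral>\<^sup>+t. (\<integral>\<^sup>+u. ennreal (?h t u) \<partial>lborel) \<partial>lborel)"
    by (simp only: inner)
  also have "\<dots> = (\<integral>\<^sup>+u. (\<integral>\<^sup>+t. ennreal (?h t u) \<partial>lborel) \<partial>lborel)"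
    by (rule lborel_pair.Fubini'[symmetric]) simp
  also have "\<dots> = (\<integral>\<^sup>+u. ennreal (Gamma \<kappa> * (indicator {0<..} u * u powr (\<mu> - \<kappa> - 1) * exp (- b * u))) \<partial>lborel)"
  proof (rule nn_integral_cong)
    fix u :: real
    show "(\<integral>\<^sup>+t. ennreal (?h t u) \<partial>lborel)
        = ennreal (Gamma \<kappa> * (indicator {0<..} u * u powr (\<mu> - \<kappa> - 1) * exp (- b * u)))"
    proof (cases "0 < u")
      case True
      have "(\<integral>\<^sup>+t. ennreal (?h t u) \<partial>lborel)
          = (\<integral>\<^sup>+t. ennreal (indicator {0<..} t * t powr (\<kappa> - 1) * exp (- u * t)) \<partial>lborel)
            * ennreal (u powr (\<mu> - 1) * exp (- b * u))"
        using True by (subst nn_integral_multc[symmetric]) (auto simp: ennreal_mult'')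
      also have "\<dots> = ennreal (Gamma \<kappa> * u powr (- \<kappa>)) * ennreal (u powr (\<mu> - 1) * exp (- b * u))"
        using True \<kappa> by (simp only: Gamma_integral_scaled(1))
      also have "\<dots> = ennreal (Gamma \<kappa> * (u powr (- \<kappa>) * u powr (\<mu> - 1)) * exp (- b * u))"
        using G by (simp add: ennreal_mult''[symmetric] mult_ac)
      also have "u powr (- \<kappa>) * u powr (\<mu> - 1) = u powr (\<mu> - \<kappa> - 1)"
        by (simp add: powr_add[symmetric] algebra_simps)
      finally show ?thesis using True by (simp add: mult_ac)
    qed simp
  qed
  also have "\<dots> = ennreal (Gamma \<kappa>) * ennreal (Gamma (\<mu> - \<kappa>) * b powr (- (\<mu> - \<kappa>)))"
    using G \<kappa> b Gamma_integral_scaled(1)[of "\<mu> - \<kappa>" b]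
    by (subst nn_integral_cmult[symmetric, THEN trans[symmetric]]) (auto simp: ennreal_mult')
  finally have eq: "ennreal (Gamma \<mu>) * (\<integral>\<^sup>+t. ennreal (?g t) \<partial>lborel)
      = ennreal (Gamma \<kappa> * (Gamma (\<mu> - \<kappa>) * b powr (\<kappa> - \<mu>)))"
    using G by (simp add: ennreal_mult'[symmetric])
  have "ennreal (1 / Gamma \<mu>) * (ennreal (Gamma \<mu>) * (\<integral>\<^sup>+t. ennreal (?g t) \<partial>lborel))
      = (\<integral>\<^sup>+t. ennreal (?g t) \<partial>lborel)"
    using G by (simp add: mult.assoc[symmetric] ennreal_mult'[symmetric])
  then have nn: "(\<integral>\<^sup>+t. ennreal (?g t) \<partial>lborel) = ennreal (Gamma \<kappa> * Gamma (\<mu> - \<kappa>) / Gamma \<mu> * b powr (\<kappa> - \<mu>))"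
    unfolding eq using G by (simp add: ennreal_mult'[symmetric] mult_ac)
  have "integrable lborel ?g \<and> (\<integral>t. ?g t \<partial>lborel) = Gamma \<kappa> * Gamma (\<mu> - \<kappa>) / Gamma \<mu> * b powr (\<kappa> - \<mu>)"
    by (rule nn_integral_eq_integrable[THEN iffD1, OF _ _ _ nn]) (use G in auto)
  then show "integrable lborel ?g"
    "(\<integral>t. ?g t \<partial>lborel) = Gamma \<kappa> * Gamma (\<mu> - \<kappa>) / Gamma \<mu> * b powr (\<kappa> - \<mu>)" by auto
qed

section \<open>Fractional Laplacians of Gaussians\<close>

text \<open>Fubini's theorem. The cosine is 1 at \<open>x = 0\<close> and \<open>f\<close> is
  nonnegative, so the bound at that point controls the total mass of \<open>f\<close> on the product
  space; this justifies the exchange of integrals for every \<open>x\<close>.\<close>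

lemma cosine_transform_mixture:
  fixes f :: "real \<Rightarrow> 'a::euclidean_space \<Rightarrow> real"
  assumes meas[measurable]: "case_prod f \<in> borel_measurable (lborel \<Otimes>\<^sub>M lborel)"
    and nonneg: "\<And>t \<xi>. 0 \<le> f t \<xi>"
    and int: "\<And>t. integrable lborel (f t)"
    and bound: "\<And>t x. \<bar>\<integral>\<xi>. f t \<xi> * cos (x \<bullet> \<xi>) \<partial>lborel\<bar> \<le> B t x"
    and B: "\<And>x. integrable lborel (\<lambda>t. B t x)"
  shows "integrable lborel (\<lambda>\<xi>. \<integral>t. f t \<xi> \<partial>lborel)"
    and "\<bar>\<integral>\<xi>. (\<integral>t. f t \<xi> \<partial>lborel) * cos (x \<bullet> \<xi>) \<partial>lborel\<bar> \<le> (\<integral>t. B t x \<partial>lborel)"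
proof -
  have "integrable lborel (\<lambda>t. \<integral>\<xi>. f t \<xi> \<partial>lborel)"
  proof (rule Bochner_Integration.integrable_bound[OF B[of 0]])
    show "AE t in lborel. norm (\<integral>\<xi>. f t \<xi> \<partial>lborel) \<le> norm (B t 0)"
      using bound[of _ 0] by (auto intro: order.trans[OF _ abs_ge_self])
  qed simp
  then have int2: "integrable (lborel \<Otimes>\<^sub>M lborel) (case_prod f)"
    using int nonneg by (intro lborel_pair.Fubini_integrable) auto
  then show "integrable lborel (\<lambda>\<xi>. \<integral>t. f t \<xi> \<partial>lborel)"
    by (rule lborel_pair.integrable_snd)
  have int3: "integrable (lborel \<Otimes>\<^sub>M lborel) (\<lambda>(t, \<xi>). f t \<xi> * cos (x \<bullet> \<xi>))"
    by (rule Bochner_Integration.integrable_bound[OF int2]) (auto simp: abs_mult nonneg mult_left_le)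
  have "(\<integral>\<xi>. (\<integral>t. f t \<xi> \<partial>lborel) * cos (x \<bullet> \<xi>) \<partial>lborel)
      = (\<integral>\<xi>. (\<integral>t. f t \<xi> * cos (x \<bullet> \<xi>) \<partial>lborel) \<partial>lborel)"
    by simp
  also have "\<dots> = (\<integral>t. (\<integral>\<xi>. f t \<xi> * cos (x \<bullet> \<xi>) \<partial>lborel) \<partial>lborel)"
    by (rule lborel_pair.Fubini_integral[OF int3])
  finally have eq: "(\<integral>\<xi>. (\<integral>t. f t \<xi> \<partial>lborel) * cos (x \<bullet> \<xi>) \<partial>lborel)
      = (\<integral>t. (\<integral>\<xi>. f t \<xi> * cos (x \<bullet> \<xi>) \<partial>lborel) \<partial>lborel)" .
  show "\<bar>\<integral>\<xi>. (\<integral>t. f t \<xi> \<partial>lborel) * cos (x \<bullet> \<xi>) \<partial>lborel\<bar> \<le> (\<integral>t. B t x \<partial>lborel)"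
    unfolding eq
    by (rule integral_abs_bound_integral[OF _ B bound]) (rule lborel_pair.integrable_fst[OF int3])
qed


text \<open>With an integer \<open>k > \<beta>\<close>, the symbol \<open>|\<xi>|\<^bsup>2\<beta>\<^esup>\<close> is a mixture of the \<open>|\<xi>|\<^bsup>2k\<^esup> exp (- t |\<xi>|\<^sup>2)\<close> with weight
  \<open>t\<^bsup>k - \<beta> - 1\<^esup> / \<Gamma>(k - \<beta>)\<close>, so the bound is inherited from the Gaussian moments.\<close>

lemma fractional_gauss_bound:
  fixes \<beta> s :: real
  assumes s: "0 < s" "s < \<beta>"
  shows "\<exists>C>0. \<forall>b>0. \<forall>x::'a::euclidean_space.
    integrable lborel (\<lambda>\<xi>::'a. norm \<xi> powr (2 * \<beta>) * exp (- b * (norm \<xi>)\<^sup>2)) \<and>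
    \<bar>\<integral>\<xi>. norm \<xi> powr (2 * \<beta>) * exp (- b * (norm \<xi>)\<^sup>2) * cos (x \<bullet> \<xi>) \<partial>lborel\<bar>
     \<le> C * b powr (- (DIM('a) / 2 + \<beta>)) * (1 + (norm x)\<^sup>2 / b) powr (- (DIM('a) / 2 + s))"
proof -
  obtain k :: nat where k: "\<beta> < k" using reals_Archimedean2 by blast
  \<comment> \<open>After the moment bound, the integrand in \<open>t\<close> is
    \<open>t powr (\<kappa> - 1) * (t + b) powr (- \<mu>)\<close>. Its integrability at infinity
    needs \<kappa> < \<mu>, which is exactly \<open>s < \<beta>\<close>.\<close>
  define \<kappa> where "\<kappa> = k - \<beta>"
  define \<mu> where "\<mu> = k - s"
  define \<gamma> where "\<gamma> = DIM('a) / 2 + s"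
  have \<kappa>: "0 < \<kappa>" "\<kappa> < \<mu>" using k s by (auto simp: \<kappa>_def \<mu>_def)
  have \<gamma>: "0 < \<gamma>" using s by (simp add: \<gamma>_def add_nonneg_pos)
  have G: "0 < Gamma \<kappa>" "0 < Gamma \<mu>" "0 < Gamma (\<mu> - \<kappa>)"
    using \<kappa> by (auto intro: Gamma_real_pos)
  obtain C where C: "0 < C" "\<And>a x. 0 < a \<Longrightarrow> \<bar>gauss_moment k a (x::'a)\<bar>
     \<le> C * a powr (- (DIM('a) / 2 + k)) * (1 + (norm x)\<^sup>2 / a) powr (- \<gamma>)"
    using gauss_moment_bound[of \<gamma> k] \<gamma> by auto
  show ?thesis
  proof (intro exI[of _ "C * Gamma (\<mu> - \<kappa>) / Gamma \<mu>"] conjI allI impI)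
    show "0 < C * Gamma (\<mu> - \<kappa>) / Gamma \<mu>" using C G by simp
    fix b :: real and x :: 'a assume b: "0 < b"
    define f where "f t \<xi> = 1 / Gamma \<kappa> * (indicator {0<..} t * t powr (\<kappa> - 1)) *
        ((norm \<xi>) ^ (2 * k) * exp (- (t + b) * (norm \<xi>)\<^sup>2))" for t and \<xi> :: 'a
    define B where "B t x = C / Gamma \<kappa> * (b powr (- \<gamma>) * (1 + (norm x)\<^sup>2 / b) powr (- \<gamma>)) *
        (indicator {0<..} t * t powr (\<kappa> - 1) * (t + b) powr (- \<mu>))" for t and x :: 'a
    have f_int: "(\<integral>t. f t \<xi> \<partial>lborel) = norm \<xi> powr (2 * \<beta>) * exp (- b * (norm \<xi>)\<^sup>2)" for \<xi> :: 'a
    proof (cases "\<xi> = 0")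
      case True
      \<comment> \<open>At the origin both sides vanish, because \<open>0 ^ (2 * k) = 0\<close> for
        nonzero \<open>k\<close> and \<open>0 powr (2 * \<beta>) = 0\<close>.\<close>
      have "k \<noteq> 0" using k s by auto
      with True show ?thesis by (simp add: f_def)
    next
      case False
      define r where "r = (norm \<xi>)\<^sup>2"
      have r: "0 < r" using False by (simp add: r_def)
      have "f t \<xi> = 1 / Gamma \<kappa> * r ^ k * exp (- b * r) *
          (indicator {0<..} t * t powr (\<kappa> - 1) * exp (- r * t))" for t
        unfolding f_def power_mult r_def[symmetric]
        by (simp add: exp_add[symmetric] algebra_simps)
      then have "(\<integral>t. f t \<xi> \<partial>lborel) = 1 / Gamma \<kappa> * r ^ k * exp (- b * r) * (Gamma \<kappa> * r powr (- \<kappa>))"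
        using Gamma_integral_scaled(3)[OF \<kappa>(1) r] by (simp only: integral_mult_right_zero)
      also have "\<dots> = r powr k * r powr (- \<kappa>) * exp (- b * r)"
        using G r by (simp add: powr_realpow)
      also have "r powr k * r powr (- \<kappa>) = norm \<xi> powr (2 * \<beta>)"
        using False by (simp add: powr_add[symmetric] \<kappa>_def r_def powr_powr flip: powr_numeral)
      finally show ?thesis by (simp add: r_def)
    qed
    have B_int: "integrable lborel (\<lambda>t. B t x)" for x
      unfolding B_def by (intro integrable_mult_right Beta_type_integral(1) \<kappa> b)
    have f_bound: "\<bar>\<integral>\<xi>. f t \<xi> * cos (x \<bullet> \<xi>) \<partial>lborel\<bar> \<le> B t x" for t and x :: 'a
    proof (cases "0 < t")
      case False
      then show ?thesis by (simp add: f_def B_def)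
    next
      case True
      define a where "a = t + b"
      define r where "r = (norm x)\<^sup>2"
      have a: "0 < a" and r: "0 \<le> r" using True b by (auto simp: a_def r_def)
      have "(\<integral>\<xi>. f t \<xi> * cos (x \<bullet> \<xi>) \<partial>lborel) = 1 / Gamma \<kappa> * t powr (\<kappa> - 1) * gauss_moment k a x"
        unfolding gauss_moment_def using True
        by (subst integral_mult_right_zero[symmetric]) (simp add: f_def a_def mult_ac)
      then have eq: "\<bar>\<integral>\<xi>. f t \<xi> * cos (x \<bullet> \<xi>) \<partial>lborel\<bar>
          = 1 / Gamma \<kappa> * t powr (\<kappa> - 1) * \<bar>gauss_moment k a x\<bar>"
        using G by (simp add: abs_mult)
      \<comment> \<open>Since \<open>b \<le> a\<close>, decay at scale \<open>a\<close> is bounded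
        by decay at scale \<open>b\<close> times a power of \<open>a / b\<close>; the dependence on
        \<open>x\<close> is thereby separated from that on \<open>t\<close>.\<close>
      have "b / a * (1 + r / b) \<le> 1 + r / a"
      proof -
        have "b / a * (1 + r / b) = b / a + r / a" using a b by (simp add: field_simps)
        moreover have "b / a \<le> 1" using a b True by (simp add: a_def)
        ultimately show ?thesis by simp
      qed
      then have "(1 + r / a) powr (- \<gamma>) \<le> (b / a * (1 + r / b)) powr (- \<gamma>)"
        using a b r \<gamma> by (intro powr_mono2' mult_pos_pos divide_pos_pos add_pos_nonneg) auto
      also have "\<dots> = a powr \<gamma> * (b powr (- \<gamma>) * (1 + r / b) powr (- \<gamma>))"
      proof -
        have "(b / a * (1 + r / b)) powr (- \<gamma>) = (b / a) powr (- \<gamma>) * (1 + r / b) powr (- \<gamma>)"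
          by (rule powr_mult)
        also have "(b / a) powr (- \<gamma>) = a powr \<gamma> * b powr (- \<gamma>)"
          using a b by (simp add: powr_divide powr_minus field_simps)
        finally show ?thesis by (simp only: mult.assoc)
      qed
      finally have "\<bar>gauss_moment k a x\<bar> \<le> C * a powr (- (DIM('a) / 2 + k)) *
          (a powr \<gamma> * (b powr (- \<gamma>) * (1 + r / b) powr (- \<gamma>)))"
        using C(1) by (intro order.trans[OF C(2)[OF a]]) (simp add: r_def mult_left_mono)
      also have "\<dots> = C * (a powr (- (DIM('a) / 2 + k)) * a powr \<gamma>) *
          (b powr (- \<gamma>) * (1 + r / b) powr (- \<gamma>))"
        by (simp only: mult.assoc)
      also have "a powr (- (DIM('a) / 2 + k)) * a powr \<gamma> = a powr (- \<mu>)"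
        by (simp add: powr_add[symmetric] \<gamma>_def \<mu>_def)
      finally have "\<bar>gauss_moment k a x\<bar> \<le> C * a powr (- \<mu>) * (b powr (- \<gamma>) * (1 + r / b) powr (- \<gamma>))" .
      then have "1 / Gamma \<kappa> * t powr (\<kappa> - 1) * \<bar>gauss_moment k a x\<bar>
          \<le> 1 / Gamma \<kappa> * t powr (\<kappa> - 1) * (C * a powr (- \<mu>) * (b powr (- \<gamma>) * (1 + r / b) powr (- \<gamma>)))"
        using G by (intro mult_left_mono) auto
      also have "\<dots> = B t x"
        using True by (simp add: B_def a_def r_def)
      finally show ?thesis unfolding eq .
    qed
    have f_meas: "case_prod f \<in> borel_measurable (lborel \<Otimes>\<^sub>M lborel)"
      unfolding f_def by measurable
    have f_nonneg: "0 \<le> f t \<xi>" for t \<xi>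
      using G by (auto simp: f_def indicator_def)
    have f_integrable: "integrable lborel (f t)" for t
    proof (cases "0 < t")
      case True
      then show ?thesis
        unfolding f_def[abs_def] using b by (intro integrable_mult_right integrable_gauss_moment) auto
    qed (simp add: f_def[abs_def])
    note * = cosine_transform_mixture[of f B, OF f_meas f_nonneg f_integrable f_bound B_int]
    show "integrable lborel (\<lambda>\<xi>::'a. norm \<xi> powr (2 * \<beta>) * exp (- b * (norm \<xi>)\<^sup>2))"
      using *(1) unfolding f_int .
    have "\<bar>\<integral>\<xi>. norm \<xi> powr (2 * \<beta>) * exp (- b * (norm \<xi>)\<^sup>2) * cos (x \<bullet> \<xi>) \<partial>lborel\<bar>
        \<le> (\<integral>t. B t x \<partial>lborel)"
      using *(2)[of x] unfolding f_int .
    also have "\<dots> = C / Gamma \<kappa> * (b powr (- \<gamma>) * (1 + (norm x)\<^sup>2 / b) powr (- \<gamma>)) *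
        (Gamma \<kappa> * Gamma (\<mu> - \<kappa>) / Gamma \<mu> * b powr (\<kappa> - \<mu>))"
      unfolding B_def using Beta_type_integral(2)[OF \<kappa> b] by (simp only: integral_mult_right_zero)
    also have "\<dots> = C * Gamma (\<mu> - \<kappa>) / Gamma \<mu> * (b powr (- \<gamma>) * b powr (\<kappa> - \<mu>)) *
        (1 + (norm x)\<^sup>2 / b) powr (- \<gamma>)"
      using G by (simp add: field_simps)
    also have "b powr (- \<gamma>) * b powr (\<kappa> - \<mu>) = b powr (- (DIM('a) / 2 + \<beta>))"
      by (simp add: powr_add[symmetric] \<gamma>_def \<kappa>_def \<mu>_def algebra_simps)
    finally show "\<bar>\<integral>\<xi>. norm \<xi> powr (2 * \<beta>) * exp (- b * (norm \<xi>)\<^sup>2) * cos (x \<bullet> \<xi>) \<partial>lborel\<bar>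
       \<le> C * Gamma (\<mu> - \<kappa>) / Gamma \<mu> * b powr (- (DIM('a) / 2 + \<beta>)) *
         (1 + (norm x)\<^sup>2 / b) powr (- (DIM('a) / 2 + s))"
      unfolding \<gamma>_def .
  qed
qed

section \<open>Subordination of the Japanese bracket to Gaussians\<close>

text \<open>The density of the Gamma distribution with shape \<gamma> and rate 1. The factor 1 in
  the exponent matches \<open>Gamma_integral_scaled\<close> with \<open>a = 1\<close>.\<close>

definition subord_weight :: "real \<Rightarrow> real \<Rightarrow> real" where
  "subord_weight \<gamma> \<tau> = 1 / Gamma \<gamma> * (indicator {0<..} \<tau> * \<tau> powr (\<gamma> - 1) * exp (- 1 * \<tau>))"

lemma subord_weight_measurable [measurable]: "subord_weight \<gamma> \<in> borel_measurable borel"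
  unfolding subord_weight_def by measurable

lemma subord_weight_nonneg: "0 < \<gamma> \<Longrightarrow> 0 \<le> subord_weight \<gamma> \<tau>"
  by (simp add: subord_weight_def Gamma_real_pos less_imp_le)

lemma subord_weight_eq_0: "\<tau> \<le> 0 \<Longrightarrow> subord_weight \<gamma> \<tau> = 0"
  by (simp add: subord_weight_def)

lemma integrable_subord_weight_powr:
  assumes "0 < \<gamma> + \<delta>"
  shows "integrable lborel (\<lambda>\<tau>. subord_weight \<gamma> \<tau> * \<tau> powr \<delta>)"
    and "(\<integral>\<tau>. subord_weight \<gamma> \<tau> * \<tau> powr \<delta> \<partial>lborel) = Gamma (\<gamma> + \<delta>) / Gamma \<gamma>"
proof -
  have eq: "subord_weight \<gamma> \<tau> * \<tau> powr \<delta> = 1 / Gamma \<gamma> *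
      (indicator {0<..} \<tau> * \<tau> powr (\<gamma> + \<delta> - 1) * exp (- 1 * \<tau>))" for \<tau>
    by (simp add: subord_weight_def powr_add powr_diff)
  show "integrable lborel (\<lambda>\<tau>. subord_weight \<gamma> \<tau> * \<tau> powr \<delta>)"
    unfolding eq by (intro integrable_mult_right Gamma_integral_scaled(2)) (use assms in auto)
  have "(\<integral>\<tau>. subord_weight \<gamma> \<tau> * \<tau> powr \<delta> \<partial>lborel) = 1 / Gamma \<gamma> * (Gamma (\<gamma> + \<delta>) * 1 powr (- (\<gamma> + \<delta>)))"
    unfolding eq integral_mult_right_zero using assms by (subst Gamma_integral_scaled(3)) auto
  then show "(\<integral>\<tau>. subord_weight \<gamma> \<tau> * \<tau> powr \<delta> \<partial>lborel) = Gamma (\<gamma> + \<delta>) / Gamma \<gamma>" by simp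
qed

lemma jbr_powr: "jbr x powr (- (2 * \<gamma>)) = (1 + (norm x)\<^sup>2) powr (- \<gamma>)"
proof -
  have "0 < 1 + (norm x)\<^sup>2" by (simp add: add_pos_nonneg)
  then show ?thesis by (simp add: jbr_def powr_half_sqrt[symmetric] powr_powr)
qed

text \<open>This is the Laplace transform of the Gamma density, evaluated at the squared
  norm.\<close>

lemma jbr_powr_subordination:
  assumes "0 < \<gamma>"
  shows "jbr x powr (- (2 * \<gamma>)) = (\<integral>\<tau>. subord_weight \<gamma> \<tau> * exp (- \<tau> * (norm x)\<^sup>2) \<partial>lborel)"
proof -
  have p: "0 < 1 + (norm x)\<^sup>2" by (simp add: add_pos_nonneg)
  have "subord_weight \<gamma> \<tau> * exp (- \<tau> * (norm x)\<^sup>2) = 1 / Gamma \<gamma> *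
      (indicator {0<..} \<tau> * \<tau> powr (\<gamma> - 1) * exp (- (1 + (norm x)\<^sup>2) * \<tau>))" for \<tau>
    by (simp add: subord_weight_def exp_diff exp_minus exp_add field_simps)
  then have "(\<integral>\<tau>. subord_weight \<gamma> \<tau> * exp (- \<tau> * (norm x)\<^sup>2) \<partial>lborel)
      = 1 / Gamma \<gamma> * (Gamma \<gamma> * (1 + (norm x)\<^sup>2) powr (- \<gamma>))"
    by (simp only: integral_mult_right_zero Gamma_integral_scaled(3)[OF assms p])
  then show ?thesis using Gamma_real_pos[OF assms] by (simp add: jbr_powr)
qed

text \<open>Each Gaussian of the mixture is transformed explicitly and the integrals are exchanged.
  The total mass is a constant times the moment of order \<open>- DIM('a) / 2\<close> of the Gamma
  density, which is finite because \<gamma> exceeds \<open>DIM('a) / 2\<close> by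
  \<open>s > 0\<close>.\<close>

lemma jbr_powr_fourier:
  fixes \<xi> :: "'a::euclidean_space"
  assumes s: "0 < s" and R: "0 < R"
  defines "\<gamma> \<equiv> DIM('a) / 2 + s"
  shows "integrable lborel (\<lambda>y::'a. jbr (y /\<^sub>R R) powr (- (2 * \<gamma>)))"
    and "fourier (\<lambda>y. complex_of_real (jbr (y /\<^sub>R R) powr (- (2 * \<gamma>)))) \<xi>
      = complex_of_real (\<integral>\<tau>. subord_weight \<gamma> \<tau> * ((pi * R\<^sup>2 / \<tau>) powr (DIM('a) / 2) *
          exp (- (R\<^sup>2 / (4 * \<tau>)) * (norm \<xi>)\<^sup>2)) \<partial>lborel)"
proof -
  have \<gamma>: "0 < \<gamma>" using s by (simp add: \<gamma>_def add_nonneg_pos)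
  define g where "g \<tau> y = exp (- (\<tau> / R\<^sup>2) * (norm y)\<^sup>2)" for \<tau> and y :: 'a
  \<comment> \<open>The frequency is kept as a parameter: the value 0 gives the integrability of the
    bracket itself, and \<open>- \<xi>\<close> gives the transform with the sign convention of
    \<open>fourier\<close>.\<close>
  define h where "h \<eta> \<tau> y = complex_of_real (subord_weight \<gamma> \<tau> * g \<tau> y) * cis (y \<bullet> \<eta>)"
    for \<eta> :: 'a and \<tau> and y :: 'a
  have h_eq: "h \<eta> \<tau> y = complex_of_real (subord_weight \<gamma> \<tau>) * (complex_of_real (exp (- (\<tau> / R\<^sup>2) * (norm y)\<^sup>2)) * cis (y \<bullet> \<eta>))"
    for \<eta> \<tau> y by (simp add: h_def g_def)
  then have h_eq': "h \<eta> \<tau> = (\<lambda>y. complex_of_real (subord_weight \<gamma> \<tau>) * (complex_of_real (exp (- (\<tau> / R\<^sup>2) * (norm y)\<^sup>2)) * cis (y \<bullet> \<eta>)))"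
    for \<eta> \<tau> by (rule ext)
  have h_int: "integrable lborel (h \<eta> \<tau>)" for \<eta> \<tau>
  proof (cases "0 < \<tau>")
    case True
    then show ?thesis
      unfolding h_eq' using R by (intro integrable_mult_right gaussian_fourier(1)) simp
  qed (simp add: h_eq' subord_weight_eq_0)
  have h_val: "(\<integral>y. h \<eta> \<tau> y \<partial>lborel) = complex_of_real (subord_weight \<gamma> \<tau> * ((pi * R\<^sup>2 / \<tau>) powr (DIM('a) / 2) *
          exp (- (R\<^sup>2 / (4 * \<tau>)) * (norm \<eta>)\<^sup>2)))" for \<eta> \<tau>
  proof (cases "0 < \<tau>")
    case True
    then have "0 < \<tau> / R\<^sup>2" using R by simp
    from gaussian_fourier(2)[OF this, of \<eta>] show ?thesis
      unfolding h_eq integral_mult_right_zero by simp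
  qed (simp add: h_eq subord_weight_eq_0)
  have norm_h: "norm (h \<eta> \<tau> y) = subord_weight \<gamma> \<tau> * g \<tau> y" for \<eta> \<tau> y
    using subord_weight_nonneg[OF \<gamma>] by (simp add: h_def norm_mult g_def)
  have norm_val: "(\<integral>y. subord_weight \<gamma> \<tau> * g \<tau> y \<partial>lborel)
      = (pi * R\<^sup>2) powr (DIM('a) / 2) * (subord_weight \<gamma> \<tau> * \<tau> powr (- (DIM('a) / 2)))" for \<tau>
  proof (cases "0 < \<tau>")
    case True
    have "complex_of_real (\<integral>y. subord_weight \<gamma> \<tau> * g \<tau> y \<partial>lborel) = (\<integral>y. h 0 \<tau> y \<partial>lborel)"
      unfolding h_def by (simp flip: integral_complex_of_real)
    also have "\<dots> = complex_of_real ((pi * R\<^sup>2) powr (DIM('a) / 2) * (subord_weight \<gamma> \<tau> * \<tau> powr (- (DIM('a) / 2))))"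
      unfolding h_val using R True by (simp add: powr_divide powr_minus field_simps)
    finally show ?thesis by (simp only: of_real_eq_iff)
  qed (simp add: subord_weight_eq_0)
  have meas: "(\<lambda>(\<tau>, y). h \<eta> \<tau> y) \<in> borel_measurable (lborel \<Otimes>\<^sub>M lborel)" for \<eta>
    unfolding h_def g_def by measurable
  have hh: "integrable (lborel \<Otimes>\<^sub>M lborel) (\<lambda>(\<tau>, y). h \<eta> \<tau> y)" for \<eta>
  proof (rule lborel_pair.Fubini_integrable[OF meas])
    show "integrable lborel (\<lambda>\<tau>. \<integral>y. norm (case (\<tau>, y) of (\<tau>, y) \<Rightarrow> h \<eta> \<tau> y) \<partial>lborel)"
      unfolding prod.case norm_h norm_val
      by (intro integrable_mult_right integrable_subord_weight_powr(1)) (use s in \<open>simp add: \<gamma>_def\<close>)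
  qed (use h_int in auto)
  have h_sub: "(\<integral>\<tau>. h \<eta> \<tau> y \<partial>lborel) = complex_of_real (jbr (y /\<^sub>R R) powr (- (2 * \<gamma>))) * cis (y \<bullet> \<eta>)"
    for \<eta> y
  proof -
    have "- \<tau> * (norm (y /\<^sub>R R))\<^sup>2 = - (\<tau> / R\<^sup>2) * (norm y)\<^sup>2" for \<tau>
      by (simp add: power_mult_distrib field_simps)
    then show ?thesis
      unfolding h_def g_def jbr_powr_subordination[OF \<gamma>] by (simp flip: integral_complex_of_real)
  qed
  have "integrable lborel (\<lambda>y. Re (\<integral>\<tau>. h 0 \<tau> y \<partial>lborel))"
    by (intro integrable_Re lborel_pair.integrable_snd[OF hh])
  then show "integrable lborel (\<lambda>y::'a. jbr (y /\<^sub>R R) powr (- (2 * \<gamma>)))"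
    unfolding h_sub by simp
  have "fourier (\<lambda>y. complex_of_real (jbr (y /\<^sub>R R) powr (- (2 * \<gamma>)))) \<xi>
      = (\<integral>y. (\<integral>\<tau>. h (- \<xi>) \<tau> y \<partial>lborel) \<partial>lborel)"
    unfolding h_sub fourier_def by simp
  also have "\<dots> = (\<integral>\<tau>. (\<integral>y. h (- \<xi>) \<tau> y \<partial>lborel) \<partial>lborel)"
    by (rule lborel_pair.Fubini_integral[OF hh])
  also have "\<dots> = complex_of_real (\<integral>\<tau>. subord_weight \<gamma> \<tau> * ((pi * R\<^sup>2 / \<tau>) powr (DIM('a) / 2) *
          exp (- (R\<^sup>2 / (4 * \<tau>)) * (norm \<xi>)\<^sup>2)) \<partial>lborel)"
    unfolding h_val norm_minus_cancel integral_complex_of_real ..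
  finally show "fourier (\<lambda>y. complex_of_real (jbr (y /\<^sub>R R) powr (- (2 * \<gamma>)))) \<xi>
      = complex_of_real (\<integral>\<tau>. subord_weight \<gamma> \<tau> * ((pi * R\<^sup>2 / \<tau>) powr (DIM('a) / 2) *
          exp (- (R\<^sup>2 / (4 * \<tau>)) * (norm \<xi>)\<^sup>2)) \<partial>lborel)" .
qed

text \<open>Take the transform at frequency zero, where the integral over \<tau> reduces to a single
  moment of the Gamma density.\<close>

lemma integral_jbr_powr:
  assumes s: "0 < s" and R: "0 < R"
  shows "(\<integral>y. jbr ((y::'a::euclidean_space) /\<^sub>R R) powr (- (real DIM('a) + 2 * s)) \<partial>lborel)
      = pi powr (DIM('a) / 2) * (Gamma s / Gamma (DIM('a) / 2 + s)) * R powr DIM('a)"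
proof -
  define \<gamma> where "\<gamma> = DIM('a) / 2 + s"
  have \<gamma>2: "real DIM('a) + 2 * s = 2 * \<gamma>" by (simp add: \<gamma>_def)
  have "complex_of_real (\<integral>y. jbr ((y::'a) /\<^sub>R R) powr (- (2 * \<gamma>)) \<partial>lborel)
      = fourier (\<lambda>y::'a. complex_of_real (jbr (y /\<^sub>R R) powr (- (2 * \<gamma>)))) 0"
    unfolding fourier_def by (simp flip: integral_complex_of_real)
  also have "\<dots> = complex_of_real (\<integral>\<tau>. subord_weight \<gamma> \<tau> * (pi * R\<^sup>2 / \<tau>) powr (DIM('a) / 2) \<partial>lborel)"
    using jbr_powr_fourier(2)[OF s R, of 0] by (simp add: \<gamma>_def)
  finally have "(\<integral>y. jbr ((y::'a) /\<^sub>R R) powr (- (2 * \<gamma>)) \<partial>lborel)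
      = (\<integral>\<tau>. subord_weight \<gamma> \<tau> * (pi * R\<^sup>2 / \<tau>) powr (DIM('a) / 2) \<partial>lborel)"
    by (simp only: of_real_eq_iff)
  also have "\<dots> = (\<integral>\<tau>. (pi * R\<^sup>2) powr (DIM('a) / 2) * (subord_weight \<gamma> \<tau> * \<tau> powr (- (DIM('a) / 2))) \<partial>lborel)"
  proof (intro Bochner_Integration.integral_cong refl)
    fix \<tau> :: real
    show "subord_weight \<gamma> \<tau> * (pi * R\<^sup>2 / \<tau>) powr (DIM('a) / 2)
        = (pi * R\<^sup>2) powr (DIM('a) / 2) * (subord_weight \<gamma> \<tau> * \<tau> powr (- (DIM('a) / 2)))"
      by (cases "0 < \<tau>") (simp_all add: subord_weight_eq_0 powr_divide powr_minus field_simps)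
  qed
  also have "\<dots> = (pi * R\<^sup>2) powr (DIM('a) / 2) * (Gamma s / Gamma \<gamma>)"
    unfolding integral_mult_right_zero
    using s by (subst integrable_subord_weight_powr(2)) (simp_all add: \<gamma>_def)
  also have "(pi * R\<^sup>2) powr (DIM('a) / 2) = pi powr (DIM('a) / 2) * R powr DIM('a)"
  proof -
    have "R\<^sup>2 = R powr 2" using R by simp
    then show ?thesis by (simp only: powr_mult powr_powr) simp
  qed
  finally show ?thesis unfolding \<gamma>2 unfolding \<gamma>_def by (simp add: mult_ac)
qed

text \<open>For \<open>v \<ge> 1\<close> the factor \<open>v\<close> only improves the decay; for
  \<open>v < 1\<close> use \<open>v * (1 + \<rho>) \<le> 1 + v * \<rho>\<close>. In
  \<open>fracA_jbr_bound\<close> this pulls the mixing parameter out of the decay factor.\<close>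

lemma one_plus_mult_powr_le:
  fixes v \<rho> \<gamma> :: real
  assumes "0 < v" "0 \<le> \<rho>" "0 < \<gamma>"
  shows "(1 + v * \<rho>) powr (- \<gamma>) \<le> (1 + v powr (- \<gamma>)) * (1 + \<rho>) powr (- \<gamma>)"
proof (cases "1 \<le> v")
  case True
  then have "\<rho> \<le> v * \<rho>" using assms by (intro mult_left_le_one_le[THEN order.trans] mult_right_mono[of 1 v \<rho>, simplified]) auto
  then have "(1 + v * \<rho>) powr (- \<gamma>) \<le> 1 * (1 + \<rho>) powr (- \<gamma>)"
    using assms by (simp add: powr_mono2')
  also have "\<dots> \<le> (1 + v powr (- \<gamma>)) * (1 + \<rho>) powr (- \<gamma>)"
    by (intro mult_right_mono) auto
  finally show ?thesis .
next
  case False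
  then have "v * (1 + \<rho>) \<le> 1 + v * \<rho>" by (simp add: algebra_simps)
  then have "(1 + v * \<rho>) powr (- \<gamma>) \<le> (v * (1 + \<rho>)) powr (- \<gamma>)"
    using assms by (intro powr_mono2') auto
  also have "\<dots> = v powr (- \<gamma>) * (1 + \<rho>) powr (- \<gamma>)"
    using assms by (simp add: powr_mult)
  also have "\<dots> \<le> (1 + v powr (- \<gamma>)) * (1 + \<rho>) powr (- \<gamma>)"
    by (intro mult_right_mono) auto
  finally show ?thesis .
qed

text \<open>The transform of the bracket is a mixture of Gaussians with rates
  \<open>R^2 / (4 \<tau>)\<close>; \<open>fractional_gauss_bound\<close> treats each of them, and
  the bounds are integrated over \<tau>. The factor \<open>c\<close> stands for the time-dependent
  part of a test function at a fixed time.\<close>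

lemma fracA_jbr_bound:
  fixes \<sigma> \<alpha> s :: real
  assumes s: "0 < s" "s < \<sigma> * \<alpha>"
  shows "\<exists>C>0. \<forall>R>0. \<forall>c. \<forall>x::'a::euclidean_space.
    \<bar>fracA \<sigma> \<alpha> (\<lambda>y. jbr (y /\<^sub>R R) powr (- (real DIM('a) + 2 * s)) * c) x\<bar>
     \<le> \<bar>c\<bar> * (C * R powr (- (2 * (\<sigma> * \<alpha>))) * jbr (x /\<^sub>R R) powr (- (real DIM('a) + 2 * s)))"
proof -
  define \<beta> where "\<beta> = \<sigma> * \<alpha>"
  define n where "n = real DIM('a)"
  define \<gamma> where "\<gamma> = n / 2 + s"
  have \<gamma>: "0 < \<gamma>" using s by (simp add: \<gamma>_def n_def add_nonneg_pos)
  have \<beta>: "0 < \<beta>" "s < \<beta>" using s by (auto simp: \<beta>_def)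
  have G: "0 < Gamma (\<gamma> + \<beta>)" "0 < Gamma \<beta>" "0 < Gamma \<gamma>"
    using \<gamma> \<beta> by (auto intro: Gamma_real_pos)
  have \<gamma>2: "real DIM('a) + 2 * s = 2 * \<gamma>" by (simp add: \<gamma>_def n_def)
  obtain C where C: "0 < C" and H: "\<forall>b>0. \<forall>x::'a.
    integrable lborel (\<lambda>\<xi>::'a. norm \<xi> powr (2 * \<beta>) * exp (- b * (norm \<xi>)\<^sup>2)) \<and>
    \<bar>\<integral>\<xi>. norm \<xi> powr (2 * \<beta>) * exp (- b * (norm \<xi>)\<^sup>2) * cos (x \<bullet> \<xi>) \<partial>lborel\<bar>
     \<le> C * b powr (- (n / 2 + \<beta>)) * (1 + (norm x)\<^sup>2 / b) powr (- \<gamma>)"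
    using fractional_gauss_bound[OF s(1) \<beta>(2), where ?'a = 'a] unfolding \<gamma>_def n_def by blast
  have Ci: "integrable lborel (\<lambda>\<xi>::'a. norm \<xi> powr (2 * \<beta>) * exp (- b * (norm \<xi>)\<^sup>2))" if "0 < b" for b
    using H that by blast
  have Cb: "\<bar>\<integral>\<xi>. norm \<xi> powr (2 * \<beta>) * exp (- b * (norm \<xi>)\<^sup>2) * cos (x \<bullet> \<xi>) \<partial>lborel\<bar>
     \<le> C * b powr (- (n / 2 + \<beta>)) * (1 + (norm x)\<^sup>2 / b) powr (- \<gamma>)" if "0 < b" for b and x :: 'a
    using H that by blast
  define K where "K = C * (4 * pi) powr (n / 2)"
  have K: "0 < K" using C by (simp add: K_def)
  \<comment> \<open>This is the weight times
    \<open>(4 \<tau>)^\<beta> (1 + (4 \<tau>)^(-\<gamma>))\<close>, the dependence on \<tau> left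
    over by \<open>one_plus_mult_powr_le\<close> with \<open>v = 4 * \<tau>\<close>. The moment of
    order \<open>\<beta> - \<gamma>\<close> is finite because \<beta> > 0.\<close>
  define W where "W \<tau> = 4 powr \<beta> * (subord_weight \<gamma> \<tau> * \<tau> powr \<beta>)
      + 4 powr (\<beta> - \<gamma>) * (subord_weight \<gamma> \<tau> * \<tau> powr (\<beta> - \<gamma>))" for \<tau>
  define J where "J = 4 powr \<beta> * (Gamma (\<gamma> + \<beta>) / Gamma \<gamma>) + 4 powr (\<beta> - \<gamma>) * (Gamma \<beta> / Gamma \<gamma>)"
  have J: "0 < J" unfolding J_def using G by (intro add_pos_pos mult_pos_pos divide_pos_pos) auto
  have W_int: "integrable lborel W" and W_val: "(\<integral>\<tau>. W \<tau> \<partial>lborel) = J"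
    using integrable_subord_weight_powr[of \<gamma> \<beta>] integrable_subord_weight_powr[of \<gamma> "\<beta> - \<gamma>"] \<gamma> \<beta>
    unfolding W_def J_def by auto
  show ?thesis
  proof (intro exI[of _ "(2 * pi) powr (- n) * (K * J)"] conjI allI impI)
    show "0 < (2 * pi) powr (- n) * (K * J)" using K J by simp
    fix R c :: real and x :: 'a assume R: "0 < R"
    define f where "f \<tau> \<xi> = subord_weight \<gamma> \<tau> * (pi * R\<^sup>2 / \<tau>) powr (n / 2) *
        (norm \<xi> powr (2 * \<beta>) * exp (- (R\<^sup>2 / (4 * \<tau>)) * (norm \<xi>)\<^sup>2))" for \<tau> and \<xi> :: 'a
    define B where "B \<tau> x = K * R powr (- (2 * \<beta>)) * (1 + (norm x)\<^sup>2 / R\<^sup>2) powr (- \<gamma>) * W \<tau>"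
      for \<tau> and x :: 'a
    define F where "F \<xi> = (\<integral>\<tau>. f \<tau> \<xi> \<partial>lborel)" for \<xi>
    have f_meas: "case_prod f \<in> borel_measurable (lborel \<Otimes>\<^sub>M lborel)"
      unfolding f_def by measurable
    have f_nonneg: "0 \<le> f \<tau> \<xi>" for \<tau> \<xi>
      using subord_weight_nonneg[OF \<gamma>] by (simp add: f_def)
    have f_integrable: "integrable lborel (f \<tau>)" for \<tau>
    proof (cases "0 < \<tau>")
      case True
      then show ?thesis unfolding f_def[abs_def] using R by (intro integrable_mult_right Ci) auto
    qed (simp add: f_def[abs_def] subord_weight_eq_0)
    have B_int: "integrable lborel (\<lambda>\<tau>. B \<tau> x)" for x
      unfolding B_def by (intro integrable_mult_right W_int)
    have f_bound: "\<bar>\<integral>\<xi>. f \<tau> \<xi> * cos (x \<bullet> \<xi>) \<partial>lborel\<bar> \<le> B \<tau> x" for \<tau> and x :: 'a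
    proof (cases "0 < \<tau>")
      case False
      then show ?thesis by (simp add: f_def B_def W_def subord_weight_eq_0)
    next
      case True
      define b where "b = R\<^sup>2 / (4 * \<tau>)"
      define \<rho> where "\<rho> = (norm x)\<^sup>2 / R\<^sup>2"
      have b: "0 < b" using True R by (simp add: b_def)
      have \<rho>: "0 \<le> \<rho>" by (simp add: \<rho>_def)
      have xb: "(norm x)\<^sup>2 / b = 4 * \<tau> * \<rho>" using R True by (simp add: b_def \<rho>_def field_simps)
      \<comment> \<open>Up to a constant the prefactor of the transformed Gaussian is
        \<open>b powr (n / 2)\<close>. It cancels against the moment bound and leaves
        \<open>b powr (- \<beta>)\<close>, the source of the power of \<open>R\<close>.\<close>
      have pb: "(pi * R\<^sup>2 / \<tau>) powr (n / 2) = (4 * pi) powr (n / 2) * b powr (n / 2)"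
        using R True by (subst powr_mult[symmetric]) (auto simp: b_def)
      have bR: "b powr (- \<beta>) = R powr (- (2 * \<beta>)) * (4 * \<tau>) powr \<beta>"
      proof -
        have "R\<^sup>2 = R powr 2" using R by simp
        then have "b powr (- \<beta>) = (R powr 2) powr (- \<beta>) / (4 * \<tau>) powr (- \<beta>)"
          using R True by (simp only: b_def powr_divide)
        also have "\<dots> = R powr (- (2 * \<beta>)) * (4 * \<tau>) powr \<beta>"
          by (simp only: powr_powr powr_minus_divide) simp
        finally show ?thesis .
      qed
      have "(\<integral>\<xi>. f \<tau> \<xi> * cos (x \<bullet> \<xi>) \<partial>lborel) = subord_weight \<gamma> \<tau> * (pi * R\<^sup>2 / \<tau>) powr (n / 2) *
          (\<integral>\<xi>. norm \<xi> powr (2 * \<beta>) * exp (- b * (norm \<xi>)\<^sup>2) * cos (x \<bullet> \<xi>) \<partial>lborel)"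
        by (subst integral_mult_right_zero[symmetric]) (simp add: f_def b_def mult_ac)
      then have "\<bar>\<integral>\<xi>. f \<tau> \<xi> * cos (x \<bullet> \<xi>) \<partial>lborel\<bar> = subord_weight \<gamma> \<tau> * (pi * R\<^sup>2 / \<tau>) powr (n / 2) *
          \<bar>\<integral>\<xi>. norm \<xi> powr (2 * \<beta>) * exp (- b * (norm \<xi>)\<^sup>2) * cos (x \<bullet> \<xi>) \<partial>lborel\<bar>"
        using subord_weight_nonneg[OF \<gamma>] by (simp add: abs_mult)
      also have "\<dots> \<le> subord_weight \<gamma> \<tau> * (pi * R\<^sup>2 / \<tau>) powr (n / 2) *
          (C * b powr (- (n / 2 + \<beta>)) * (1 + (norm x)\<^sup>2 / b) powr (- \<gamma>))"
        by (intro mult_left_mono Cb b) (simp add: subord_weight_nonneg[OF \<gamma>])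
      also have "\<dots> = subord_weight \<gamma> \<tau> * K * (b powr (n / 2) * b powr (- (n / 2 + \<beta>))) *
          (1 + 4 * \<tau> * \<rho>) powr (- \<gamma>)"
        unfolding pb xb K_def by (simp only: mult_ac)
      also have "b powr (n / 2) * b powr (- (n / 2 + \<beta>)) = R powr (- (2 * \<beta>)) * (4 * \<tau>) powr \<beta>"
        unfolding bR[symmetric] by (simp add: powr_add[symmetric])
      also have "subord_weight \<gamma> \<tau> * K * (R powr (- (2 * \<beta>)) * (4 * \<tau>) powr \<beta>) * (1 + 4 * \<tau> * \<rho>) powr (- \<gamma>)
        \<le> subord_weight \<gamma> \<tau> * K * (R powr (- (2 * \<beta>)) * (4 * \<tau>) powr \<beta>) *
          ((1 + (4 * \<tau>) powr (- \<gamma>)) * (1 + \<rho>) powr (- \<gamma>))"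
        using K True \<rho> \<gamma> subord_weight_nonneg[OF \<gamma>, of \<tau>]
        by (intro mult_left_mono one_plus_mult_powr_le mult_nonneg_nonneg) auto
      also have "\<dots> = B \<tau> x"
        using True unfolding B_def W_def \<rho>_def[symmetric]
        by (simp add: powr_mult powr_diff powr_minus field_simps)
      finally show ?thesis .
    qed
    note * = cosine_transform_mixture[of f B, OF f_meas f_nonneg f_integrable f_bound B_int]
    have F_int: "integrable lborel F" using *(1) unfolding F_def .
    have "\<bar>\<integral>\<xi>. F \<xi> * cos (x \<bullet> \<xi>) \<partial>lborel\<bar> \<le> (\<integral>\<tau>. B \<tau> x \<partial>lborel)"
      using *(2) unfolding F_def .
    also have "\<dots> = K * J * R powr (- (2 * \<beta>)) * (1 + (norm x)\<^sup>2 / R\<^sup>2) powr (- \<gamma>)"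
      unfolding B_def integral_mult_right_zero W_val by (simp add: mult_ac)
    also have "(norm x)\<^sup>2 / R\<^sup>2 = (norm (x /\<^sub>R R))\<^sup>2"
      by (simp add: power_mult_distrib field_simps)
    finally have bound: "\<bar>\<integral>\<xi>. F \<xi> * cos (x \<bullet> \<xi>) \<partial>lborel\<bar>
        \<le> K * J * R powr (- (2 * \<beta>)) * jbr (x /\<^sub>R R) powr (- (2 * \<gamma>))"
      unfolding jbr_powr .
    \<comment> \<open>The function to be inverted is real, so the real part taken in
      \<open>fracA\<close> leaves a cosine integral.\<close>
    have four: "complex_of_real (norm \<xi> powr (2 * \<sigma> * \<alpha>)) *
        fourier (\<lambda>y. complex_of_real (jbr (y /\<^sub>R R) powr (- (2 * \<gamma>)) * c)) \<xi>
        = complex_of_real (c * F \<xi>)" for \<xi> :: 'a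
    proof -
      have "fourier (\<lambda>y. complex_of_real (jbr (y /\<^sub>R R) powr (- (2 * \<gamma>)) * c)) \<xi>
          = complex_of_real c * fourier (\<lambda>y. complex_of_real (jbr (y /\<^sub>R R) powr (- (2 * \<gamma>)))) \<xi>"
        unfolding fourier_def by (subst integral_mult_right_zero[symmetric]) (simp add: mult_ac)
      moreover have "F \<xi> = norm \<xi> powr (2 * \<sigma> * \<alpha>) * (\<integral>\<tau>. subord_weight \<gamma> \<tau> *
          ((pi * R\<^sup>2 / \<tau>) powr (n / 2) * exp (- (R\<^sup>2 / (4 * \<tau>)) * (norm \<xi>)\<^sup>2)) \<partial>lborel)"
        unfolding F_def f_def \<beta>_def by (subst integral_mult_right_zero[symmetric]) (simp add: mult_ac)
      ultimately show ?thesis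
        using jbr_powr_fourier(2)[OF s(1) R, of \<xi>] by (simp add: \<gamma>_def n_def)
    qed
    have int: "integrable lborel (\<lambda>\<xi>. complex_of_real (c * F \<xi>) * cis (x \<bullet> \<xi>))"
      using F_int by (intro Bochner_Integration.integrable_bound[OF integrable_mult_right[OF F_int, of c]])
        (auto simp: norm_mult abs_mult)
    have "fracA \<sigma> \<alpha> (\<lambda>y. jbr (y /\<^sub>R R) powr (- (2 * \<gamma>)) * c) x
        = (2 * pi) powr (- n) * Re (\<integral>\<xi>. complex_of_real (c * F \<xi>) * cis (x \<bullet> \<xi>) \<partial>lborel)"
      unfolding fracA_def inv_fourier_def four n_def
      by simp
    also have "Re (\<integral>\<xi>. complex_of_real (c * F \<xi>) * cis (x \<bullet> \<xi>) \<partial>lborel) = (\<integral>\<xi>. c * (F \<xi> * cos (x \<bullet> \<xi>)) \<partial>lborel)"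
      unfolding integral_Re[OF int, symmetric] by (simp add: mult_ac)
    also have "\<dots> = c * (\<integral>\<xi>. F \<xi> * cos (x \<bullet> \<xi>) \<partial>lborel)"
      by (rule integral_mult_right_zero)
    finally have "\<bar>fracA \<sigma> \<alpha> (\<lambda>y. jbr (y /\<^sub>R R) powr (- (2 * \<gamma>)) * c) x\<bar>
        = \<bar>c\<bar> * (2 * pi) powr (- n) * \<bar>\<integral>\<xi>. F \<xi> * cos (x \<bullet> \<xi>) \<partial>lborel\<bar>"
      by (simp add: abs_mult mult_ac)
    also have "\<dots> \<le> \<bar>c\<bar> * (2 * pi) powr (- n) * (K * J * R powr (- (2 * \<beta>)) * jbr (x /\<^sub>R R) powr (- (2 * \<gamma>)))"
      by (intro mult_left_mono bound) auto
    finally show "\<bar>fracA \<sigma> \<alpha> (\<lambda>y. jbr (y /\<^sub>R R) powr (- (real DIM('a) + 2 * s)) * c) x\<bar>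
     \<le> \<bar>c\<bar> * ((2 * pi) powr (- n) * (K * J) * R powr (- (2 * (\<sigma> * \<alpha>))) *
         jbr (x /\<^sub>R R) powr (- (real DIM('a) + 2 * s)))"
      unfolding \<gamma>2 \<beta>_def by (simp only: mult.assoc)
  qed
qed

section \<open>Cutoff functions in time\<close>

text \<open>The polynomial parameter makes this a class closed under differentiation; constant
  \<open>q\<close> gives the standard smooth cutoff.\<close>

definition flat :: "real poly \<Rightarrow> real \<Rightarrow> real" where
  "flat q y = (if 0 < y then poly q (1 / y) * exp (- (1 / y)) else 0)"

lemma poly_exp_bounded:
  fixes q :: "real poly"
  assumes "0 < \<delta>"
  shows "\<exists>C>0. \<forall>z\<ge>0. \<bar>poly q z\<bar> * exp (- \<delta> * z) \<le> C"
proof -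
  obtain C where "0 < C" "\<And>z. z \<ge> 0 \<Longrightarrow> \<bar>poly q z\<bar> * (1 + z) powr 0 * exp (- \<delta> * z) \<le> C"
    using poly_powr_exp_bounded[of 0 \<delta> q] assms by auto
  then show ?thesis by (intro exI[of _ C]) (auto simp: add_nonneg_eq_0_iff)
qed

text \<open>For \<open>y > 0\<close> and \<open>z = 1 / y\<close>, the chain rule produces the
  factor \<open>z^2\<close>, which is encoded by the two \<open>pCons 0\<close>. At the origin, the
  value at \<open>h\<close> is \<open>h^2\<close> times the bounded quantity
  \<open>z^2 q(z) exp (-z)\<close> with \<open>z = 1 / h\<close>, so the derivative is 0.\<close>

lemma DERIV_flat: "(flat q has_real_derivative flat (pCons 0 (pCons 0 (q - pderiv q))) y) (at y)"
proof (cases y "0::real" rule: linorder_cases)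
  case less
  have "(flat q has_real_derivative 0) (at y)"
    by (rule has_field_derivative_transform_within_open[where f = "\<lambda>_. 0" and S = "{..<0}"])
      (use less in \<open>auto simp: flat_def\<close>)
  then show ?thesis using less by (simp add: flat_def)
next
  case equal
  obtain C where C: "0 < C" "\<And>z. z \<ge> 0 \<Longrightarrow> \<bar>poly (pCons 0 (pCons 0 q)) z\<bar> * exp (- 1 * z) \<le> C"
    using poly_exp_bounded[of 1 "pCons 0 (pCons 0 q)"] by auto
  have "(flat q has_real_derivative 0) (at 0)"
  proof (rule has_real_derivative_quadratic_remainder[where d = 1 and C = C])
    fix h :: real
    show "\<bar>flat q (0 + h) - flat q 0 - h * 0\<bar> \<le> C * h\<^sup>2"
    proof (cases "0 < h")
      case True
      then have "\<bar>flat q h\<bar> = (\<bar>poly (pCons 0 (pCons 0 q)) (1 / h)\<bar> * exp (- 1 * (1 / h))) * h\<^sup>2"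
        by (simp add: flat_def abs_mult power2_eq_square)
      also have "\<dots> \<le> C * h\<^sup>2"
        using True by (intro mult_right_mono C(2)) auto
      finally show ?thesis by (simp add: flat_def)
    qed (use C in \<open>simp add: flat_def\<close>)
  qed simp
  then show ?thesis using equal by (simp add: flat_def)
next
  case greater
  have d1: "((\<lambda>y. 1 / y) has_real_derivative - 1 / y\<^sup>2) (at y)"
    using greater by (auto intro!: derivative_eq_intros simp: power2_eq_square)
  have d2: "((\<lambda>y. poly q (1 / y) * exp (- (1 / y))) has_real_derivative
      poly (pderiv q) (1 / y) * (- 1 / y\<^sup>2) * exp (- (1 / y)) +
      exp (- (1 / y)) * (- (- 1 / y\<^sup>2)) * poly q (1 / y)) (at y)"
    by (intro DERIV_mult DERIV_chain2[OF poly_DERIV d1] DERIV_chain2[OF DERIV_exp] DERIV_minus d1)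
  have "(flat q has_real_derivative
      poly (pderiv q) (1 / y) * (- 1 / y\<^sup>2) * exp (- (1 / y)) +
      exp (- (1 / y)) * (- (- 1 / y\<^sup>2)) * poly q (1 / y)) (at y)"
    by (rule has_field_derivative_transform_within_open[OF d2, where S = "{0<..}"])
      (use greater in \<open>auto simp: flat_def\<close>)
  then show ?thesis
    by (rule DERIV_cong) (use greater in \<open>simp add: flat_def field_simps power2_eq_square\<close>)
qed

lemma higher_deriv_flat: "\<exists>q'. (deriv ^^ k) (\<lambda>t. flat q (1 - t)) = (\<lambda>t. flat q' (1 - t))"
proof (induction k)
  case 0
  show ?case by auto
next
  case (Suc k)
  then obtain q' where q': "(deriv ^^ k) (\<lambda>t. flat q (1 - t)) = (\<lambda>t. flat q' (1 - t))" by blast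
  define q'' where "q'' = - pCons 0 (pCons 0 (q' - pderiv q'))"
  have "((\<lambda>t. flat q' (1 - t)) has_real_derivative flat q'' (1 - t)) (at t)" for t
  proof -
    have "((\<lambda>t. 1 - t) has_real_derivative - 1) (at t)"
      by (auto intro!: derivative_eq_intros)
    moreover have "flat (- r) y = - flat r y" for r y
      by (simp add: flat_def)
    ultimately show ?thesis
      using DERIV_chain2[OF DERIV_flat, of "\<lambda>t. 1 - t" "- 1" t UNIV q']
      unfolding q''_def by (simp only: mult_minus1_right)
  qed
  then have "deriv (\<lambda>t. flat q' (1 - t)) = (\<lambda>t. flat q'' (1 - t))"
    by (intro ext DERIV_imp_deriv)
  then show ?case using q' by auto
qed

lemma smooth_fun_flat: "smooth_fun (\<lambda>t. flat q (1 - t))"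
  unfolding smooth_fun_def
proof (intro allI)
  fix k t
  obtain q' where q': "(deriv ^^ k) (\<lambda>t. flat q (1 - t)) = (\<lambda>t. flat q' (1 - t))"
    using higher_deriv_flat by blast
  have "((\<lambda>t. 1 - t) has_real_derivative - 1) (at t)"
    by (auto intro!: derivative_eq_intros)
  from DERIV_chain2[OF DERIV_flat this, of q']
  show "(deriv ^^ k) (\<lambda>t. flat q (1 - t)) differentiable at t"
    unfolding q' real_differentiable_def by blast
qed

text \<open>Up to a constant factor the cutoff is \<open>exp (- 1 / (1 - t))\<close>. Its derivatives carry the same
  exponential times a polynomial in \<open>1 / (1 - t)\<close>, so they are dominated by any smaller power of it.\<close>

lemma cutoff_exists:
  fixes p :: real
  assumes p: "1 < p"
  shows "\<exists>\<psi> C. smooth_fun \<psi> \<and> \<psi> 0 = 1 \<and> (\<forall>t. 0 \<le> \<psi> t) \<and> (\<forall>t\<ge>0. \<psi> t \<le> 1) \<and> (\<forall>t\<ge>1. \<psi> t = 0) \<and>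
    0 < C \<and> (\<forall>k\<le>3. \<forall>t. \<bar>(deriv ^^ k) \<psi> t\<bar> \<le> C * \<psi> t powr (1 / p))"
proof -
  \<comment> \<open>The constant \<open>exp 1\<close> normalises the value at 0 to 1.\<close>
  define \<psi> where "\<psi> t = flat [:exp 1:] (1 - t)" for t
  have \<psi>: "\<psi> t = (if t < 1 then exp (1 - 1 / (1 - t)) else 0)" for t
    by (simp add: \<psi>_def flat_def mult_exp_exp)
  have bound: "\<exists>C>0. \<forall>t. \<bar>(deriv ^^ k) \<psi> t\<bar> \<le> C * \<psi> t powr (1 / p)" for k
  proof -
    obtain q where q: "(deriv ^^ k) \<psi> = (\<lambda>t. flat q (1 - t))"
      using higher_deriv_flat[of k "[:exp 1:]"] unfolding \<psi>_def[abs_def] by blast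
    \<comment> \<open>The exponential is split into the share \<open>exp (- z / p)\<close>, which is
      \<open>\<psi> t powr (1 / p)\<close> up to a constant factor, and a remainder of rate
      \<open>1 - 1 / p\<close>, which absorbs the polynomial.\<close>
    have "0 < 1 - 1 / p" using p by simp
    then obtain C where C: "0 < C" "\<And>z. z \<ge> 0 \<Longrightarrow> \<bar>poly q z\<bar> * exp (- (1 - 1 / p) * z) \<le> C"
      using poly_exp_bounded[of "1 - 1 / p" q] by auto
    show ?thesis
    proof (intro exI[of _ C] conjI allI C(1))
      fix t
      show "\<bar>(deriv ^^ k) \<psi> t\<bar> \<le> C * \<psi> t powr (1 / p)"
      proof (cases "t < 1")
        case True
        define z where "z = 1 / (1 - t)"
        have z: "0 \<le> z" using True by (simp add: z_def)
        have "exp (- z) = exp (- (1 - 1 / p) * z) * exp (- z / p)"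
          by (simp add: exp_add[symmetric] algebra_simps)
        then have "\<bar>flat q (1 - t)\<bar> = \<bar>poly q z\<bar> * exp (- (1 - 1 / p) * z) * exp (- z / p)"
          using True by (simp add: flat_def abs_mult z_def)
        also have "\<dots> \<le> C * exp ((1 - z) / p)"
        proof (intro mult_mono C z)
          show "exp (- z / p) \<le> exp ((1 - z) / p)"
            using p by (simp add: diff_divide_distrib)
        qed (use C in auto)
        also have "exp ((1 - z) / p) = \<psi> t powr (1 / p)"
          using True by (simp add: \<psi> z_def powr_def)
        finally show ?thesis unfolding q .
      qed (simp add: q flat_def \<psi>)
    qed
  qed
  then obtain C where C: "\<And>k. 0 < C k" "\<And>k t. \<bar>(deriv ^^ k) \<psi> t\<bar> \<le> C k * \<psi> t powr (1 / p)"
    by metis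
  have "\<bar>(deriv ^^ k) \<psi> t\<bar> \<le> (C 0 + C 1 + C 2 + C 3) * \<psi> t powr (1 / p)" if "k \<le> 3" for k t
  proof -
    have "k = 0 \<or> k = 1 \<or> k = 2 \<or> k = 3" using that by auto
    then have "C k \<le> C 0 + C 1 + C 2 + C 3"
      using C(1)[of 0] C(1)[of 1] C(1)[of 2] C(1)[of 3] by auto
    then show ?thesis
      by (intro order.trans[OF C(2)] mult_right_mono) auto
  qed
  moreover have "0 < C 0 + C 1 + C 2 + C 3"
    using C(1) by (intro add_pos_pos)
  moreover have "smooth_fun \<psi>" unfolding \<psi>_def[abs_def] by (rule smooth_fun_flat)
  \<comment> \<open>This fails for negative \<open>t\<close>, where the exponent
    \<open>1 - 1 / (1 - t)\<close> is positive.\<close>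
  moreover have "\<forall>t\<ge>0. \<psi> t \<le> 1" by (auto simp: \<psi> field_simps)
  moreover have "\<psi> 0 = 1" "\<forall>t. 0 \<le> \<psi> t" "\<forall>t\<ge>1. \<psi> t = 0" by (auto simp: \<psi>)
  ultimately show ?thesis by blast
qed

text \<open>Each derivative costs a factor \<open>d\<close>. With
  \<open>d = R powr (- (2 * \<sigma> / 3))\<close>, three of them cost the same power of
  \<open>R\<close> as the full operator with \<alpha> = 1.\<close>

lemma higher_deriv_scaled:
  assumes "smooth_fun \<psi>"
  shows "(deriv ^^ k) (\<lambda>\<tau>. c * \<psi> (\<tau> * d)) = (\<lambda>\<tau>. c * (d ^ k * (deriv ^^ k) \<psi> (\<tau> * d)))"
    and "((\<lambda>\<tau>. c * (d ^ k * (deriv ^^ k) \<psi> (\<tau> * d))) has_real_derivative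
      c * (d ^ Suc k * (deriv ^^ Suc k) \<psi> (\<tau> * d))) (at \<tau>)"
proof -
  have D: "((\<lambda>\<tau>. c * (d ^ k * (deriv ^^ k) \<psi> (\<tau> * d))) has_real_derivative
      c * (d ^ Suc k * (deriv ^^ Suc k) \<psi> (\<tau> * d))) (at \<tau>)" for k \<tau>
  proof -
    have "((deriv ^^ k) \<psi> has_real_derivative (deriv ^^ Suc k) \<psi> (\<tau> * d)) (at (\<tau> * d))"
      using assms unfolding smooth_fun_def
      by (simp add: DERIV_deriv_iff_real_differentiable)
    moreover have "((\<lambda>\<tau>. \<tau> * d) has_real_derivative d) (at \<tau>)"
      by (auto intro!: derivative_eq_intros)
    ultimately have "((\<lambda>\<tau>. (deriv ^^ k) \<psi> (\<tau> * d)) has_real_derivative (deriv ^^ Suc k) \<psi> (\<tau> * d) * d) (at \<tau>)"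
      by (rule DERIV_chain2)
    then have "((\<lambda>\<tau>. c * (d ^ k * (deriv ^^ k) \<psi> (\<tau> * d))) has_real_derivative
        c * (d ^ k * ((deriv ^^ Suc k) \<psi> (\<tau> * d) * d))) (at \<tau>)"
      by (intro DERIV_cmult)
    then show ?thesis
      by (rule DERIV_cong) simp
  qed
  then show "((\<lambda>\<tau>. c * (d ^ k * (deriv ^^ k) \<psi> (\<tau> * d))) has_real_derivative
      c * (d ^ Suc k * (deriv ^^ Suc k) \<psi> (\<tau> * d))) (at \<tau>)" .
  show "(deriv ^^ k) (\<lambda>\<tau>. c * \<psi> (\<tau> * d)) = (\<lambda>\<tau>. c * (d ^ k * (deriv ^^ k) \<psi> (\<tau> * d)))"
  proof (induction k)
    case (Suc k)
    have "deriv (\<lambda>\<tau>. c * (d ^ k * (deriv ^^ k) \<psi> (\<tau> * d))) = (\<lambda>\<tau>. c * (d ^ Suc k * (deriv ^^ Suc k) \<psi> (\<tau> * d)))"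
      by (intro ext DERIV_imp_deriv D)
    with Suc show ?case by simp
  qed simp
qed

lemma smooth_fun_scaled:
  assumes "smooth_fun \<psi>"
  shows "smooth_fun (\<lambda>t. \<psi> (t * d))"
  unfolding smooth_fun_def
proof (intro allI)
  fix k t
  show "(deriv ^^ k) (\<lambda>t. \<psi> (t * d)) differentiable at t"
    using higher_deriv_scaled(2)[OF assms, of 1 d k t] higher_deriv_scaled(1)[OF assms, of k 1 d]
    unfolding real_differentiable_def by auto
qed

section \<open>The test function method\<close>

text \<open>Compare \<open>a\<close> with \<open>\<delta> * b powr (1 / (p - 1))\<close>: below this
  threshold the first term dominates \<open>a * b\<close>, and above it \<open>b\<close> is at most
  \<open>(a / \<delta>) powr (p - 1)\<close>. The minimum keeps \<open>a * b\<close> itself, which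
  tends to 0 with \<open>b\<close>, beside a bound free of \<open>b\<close> that serves as a
  majorant.\<close>

lemma young_min:
  fixes a b p \<delta> :: real
  assumes a: "0 \<le> a" and b: "0 \<le> b" and p: "1 < p" and \<delta>: "0 < \<delta>"
  shows "a * b \<le> \<delta> * b powr (p / (p - 1)) + min (a * b) (\<delta> powr (1 - p) * a powr p)"
proof (cases "a \<le> \<delta> * b powr (1 / (p - 1))")
  case True
  have "b powr (1 / (p - 1)) * b = b powr (p / (p - 1))"
  proof (cases "b = 0")
    case False
    have "1 / (p - 1) + 1 = p / (p - 1)" using p by (simp add: field_simps)
    then show ?thesis using False b powr_add[of b "1 / (p - 1)" 1] by simp
  qed simp
  then have "a * b \<le> \<delta> * b powr (p / (p - 1))"
    using mult_right_mono[OF True b] by (simp add: mult.assoc)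
  moreover have "0 \<le> min (a * b) (\<delta> powr (1 - p) * a powr p)"
    using a b by simp
  ultimately show ?thesis by linarith
next
  case False
  then have a0: "0 < a" using \<delta> by (smt (verit) mult_nonneg_nonneg powr_ge_zero)
  have "b = (b powr (1 / (p - 1))) powr (p - 1)"
    using b p by (simp add: powr_powr)
  also have "\<dots> \<le> (a / \<delta>) powr (p - 1)"
    using False p \<delta> by (intro powr_mono2) (auto simp: field_simps)
  also have "\<dots> = a powr (p - 1) * \<delta> powr (1 - p)"
    using a0 \<delta> by (simp add: powr_divide powr_diff field_simps)
  finally have "a * b \<le> a * (a powr (p - 1) * \<delta> powr (1 - p))"
    using a by (rule mult_left_mono)
  also have "\<dots> = \<delta> powr (1 - p) * a powr p"
    using a0 by (simp add: powr_diff)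
  finally have "a * b \<le> \<delta> powr (1 - p) * a powr p" .
  moreover have "0 \<le> \<delta> * b powr (p / (p - 1))" using \<delta> by simp
  ultimately show ?thesis by (auto simp: min_def)
qed

text \<open>Here \<open>G \<theta>\<^sup>p\<close> is the test function, \<open>v\<close> the modulus of the solution and \<open>D\<close> the contribution of
  the data. The inequality \<open>young_min\<close> with a fixed \<open>\<delta>\<close> shows that \<open>v\<^sup>p\<close> is integrable; then \<open>v\<^sup>p\<close> dominates
  the minimum in it, whose integral tends to 0 because \<open>b\<close> does, and \<open>\<delta>\<close> can be taken small.\<close>

lemma test_function_argument:
  fixes v :: "'z \<Rightarrow> real" and G \<theta> w :: "nat \<Rightarrow> 'z \<Rightarrow> real" and b D :: "nat \<Rightarrow> real"
  assumes p: "1 < p"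
    and v[measurable]: "v \<in> borel_measurable M" and v0: "\<And>z. 0 \<le> v z"
    and G: "\<And>k. integrable M (G k)" "\<And>k z. 0 \<le> G k z" "\<And>k z. G k z \<le> 1"
    and \<theta>: "\<And>k z. 0 \<le> \<theta> k z" "\<And>k z. \<theta> k z \<le> 1"
    and b: "\<And>k. 0 \<le> b k" "b \<longlonglongrightarrow> 0" "\<And>k. b k powr (p / (p - 1)) * (\<integral>z. G k z \<partial>M) \<le> C"
    and I: "\<And>k. integrable M (\<lambda>z. v z powr p * (G k z * \<theta> k z powr p))"
    and lim: "\<And>z. (\<lambda>k. v z powr p * (G k z * \<theta> k z powr p)) \<longlonglongrightarrow> v z powr p"
    and w: "\<And>k. integrable M (w k)" "\<And>k z. w k z \<le> b k * v z * (G k z * \<theta> k z)"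
    and eq: "\<And>k. (\<integral>z. v z powr p * (G k z * \<theta> k z powr p) \<partial>M) + D k \<le> (\<integral>z. w k z \<partial>M)"
    and D: "D \<longlonglongrightarrow> D0"
  shows "D0 \<le> 0"
proof -
  define I' where "I' k = (\<integral>z. v z powr p * (G k z * \<theta> k z powr p) \<partial>M)" for k
  have I'0: "0 \<le> I' k" for k
    unfolding I'_def by (intro integral_nonneg_AE) (auto simp: G)
  have \<delta>C: "(\<integral>z. \<delta> * b k powr (p / (p - 1)) * G k z \<partial>M) \<le> \<delta> * C" if "0 < \<delta>" for \<delta> k
    using mult_left_mono[OF b(3)[of k], of \<delta>] that by (simp add: mult.assoc)

  \<comment> \<open>Chosen so that the coefficient \<open>\<delta>0 powr (1 - p)\<close> in
    \<open>young_min\<close> is 1/2; half of \<open>I' k\<close> can then be absorbed on the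
    left.\<close>
  define \<delta>0 where "\<delta>0 = 2 powr (1 / (p - 1))"
  have \<delta>0: "0 < \<delta>0" by (simp add: \<delta>0_def)
  have "1 / (p - 1) * (1 - p) = - 1" using p by (simp add: field_simps)
  then have \<delta>0p: "\<delta>0 powr (1 - p) = 1 / 2" by (simp add: \<delta>0_def powr_powr powr_minus)
  have step1: "I' k \<le> 2 * (\<delta>0 * C - D k)" for k
  proof -
    have "(\<integral>z. w k z \<partial>M) \<le> (\<integral>z. \<delta>0 * b k powr (p / (p - 1)) * G k z
        + 1 / 2 * (v z powr p * (G k z * \<theta> k z powr p)) \<partial>M)"
    proof (intro integral_mono w Bochner_Integration.integrable_add integrable_mult_right G I)
      fix z
      have "(v z * \<theta> k z) * b k \<le> \<delta>0 * b k powr (p / (p - 1)) + 1 / 2 * (v z * \<theta> k z) powr p"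
        using young_min[OF mult_nonneg_nonneg[OF v0[of z] \<theta>(1)[of k z]] b(1)[of k] p \<delta>0] unfolding \<delta>0p
        by (rule order.trans) simp
      then have "(v z * \<theta> k z) * b k * G k z
          \<le> (\<delta>0 * b k powr (p / (p - 1)) + 1 / 2 * (v z * \<theta> k z) powr p) * G k z"
        using G by (intro mult_right_mono)
      also have "(v z * \<theta> k z) powr p = v z powr p * \<theta> k z powr p"
        by (rule powr_mult)
      finally show "w k z \<le> \<delta>0 * b k powr (p / (p - 1)) * G k z
          + 1 / 2 * (v z powr p * (G k z * \<theta> k z powr p))"
        using w(2)[of k z] by (simp add: algebra_simps)
    qed
    also have "\<dots> = (\<integral>z. \<delta>0 * b k powr (p / (p - 1)) * G k z \<partial>M) + 1 / 2 * I' k"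
      unfolding I'_def
      by (subst Bochner_Integration.integral_add) (auto intro!: integrable_mult_right G I)
    finally have "I' k + D k \<le> \<delta>0 * C + 1 / 2 * I' k"
      using eq[of k] \<delta>C[OF \<delta>0, of k] unfolding I'_def by linarith
    then show ?thesis by simp
  qed

  \<comment> \<open>Fatou's lemma: the weights tend to 1, and \<open>step1\<close> together with the
    boundedness of the convergent sequence \<open>D\<close> bounds the weighted integrals.\<close>
  have V: "integrable M (\<lambda>z. v z powr p)"
  proof -
    obtain Kd where Kd: "\<And>k. norm (D k) \<le> Kd"
      using convergent_imp_Bseq[of D] D by (auto simp: convergent_def Bseq_def)
    have "(\<integral>\<^sup>+z. ennreal (v z powr p) \<partial>M)
        = (\<integral>\<^sup>+z. liminf (\<lambda>k. ennreal (v z powr p * (G k z * \<theta> k z powr p))) \<partial>M)"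
      by (intro nn_integral_cong lim_imp_Liminf[symmetric] tendsto_ennrealI lim) simp
    also have "\<dots> \<le> liminf (\<lambda>k. \<integral>\<^sup>+z. ennreal (v z powr p * (G k z * \<theta> k z powr p)) \<partial>M)"
      using I by (intro nn_integral_liminf) (auto dest: borel_measurable_integrable)
    also have "\<dots> = liminf (\<lambda>k. ennreal (I' k))"
      unfolding I'_def by (subst nn_integral_eq_integral[OF I]) (auto simp: G)
    also have "\<dots> \<le> liminf (\<lambda>k::nat. ennreal (2 * (\<delta>0 * C + Kd)))"
    proof (intro Liminf_mono always_eventually allI ennreal_leI)
      fix k
      show "I' k \<le> 2 * (\<delta>0 * C + Kd)"
        using step1[of k] Kd[of k] by (simp add: abs_le_iff)
    qed
    also have "\<dots> < \<infinity>" by (simp add: Liminf_const)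
    finally show ?thesis by (intro integrableI_bounded) auto
  qed

  have "D0 \<le> \<delta> * C" if \<delta>: "0 < \<delta>" for \<delta>
  proof -
    define m where "m k z = min (v z * b k) (\<delta> powr (1 - p) * v z powr p)" for k z
    have m_int: "integrable M (m k)" for k
      unfolding m_def[abs_def]
      by (rule Bochner_Integration.integrable_bound[OF integrable_mult_right[OF V, of "\<delta> powr (1 - p)"]])
        (auto simp: v0 b)
    have m0: "(\<lambda>k. \<integral>z. m k z \<partial>M) \<longlonglongrightarrow> (\<integral>z. 0 \<partial>M)"
    proof (rule integral_dominated_convergence[where w = "\<lambda>z. \<delta> powr (1 - p) * v z powr p"])
      show "AE z in M. (\<lambda>k. m k z) \<longlonglongrightarrow> 0"
      proof (intro AE_I2)
        fix z
        have vb: "(\<lambda>k. v z * b k) \<longlonglongrightarrow> 0" by (intro tendsto_mult_right_zero b)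
        show "(\<lambda>k. m k z) \<longlonglongrightarrow> 0"
          by (rule tendsto_sandwich[OF _ _ tendsto_const vb]) (auto simp: m_def v0 b)
      qed
      show "AE z in M. norm (m k z) \<le> \<delta> powr (1 - p) * v z powr p" for k
        by (auto simp: m_def v0 b)
    qed (use V m_int in \<open>auto dest: borel_measurable_integrable\<close>)
    have "D k \<le> \<delta> * C + (\<integral>z. m k z \<partial>M)" for k
    proof -
      have "(\<integral>z. w k z \<partial>M) \<le> (\<integral>z. \<delta> * b k powr (p / (p - 1)) * G k z + m k z \<partial>M)"
      proof (intro integral_mono w Bochner_Integration.integrable_add integrable_mult_right G m_int)
        fix z
        \<comment> \<open>In contrast to \<open>step1\<close>, the factor \<theta> is dropped and
          Young's inequality is applied to \<open>v\<close> itself, which is possible because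
          \<open>v^p\<close> is now known to be integrable.\<close>
        have "w k z \<le> (v z * b k) * (G k z * \<theta> k z)" using w(2)[of k z] by (simp add: mult_ac)
        also have "\<dots> \<le> (v z * b k) * (G k z * 1)"
          using v0 b G \<theta> by (intro mult_left_mono) auto
        also have "\<dots> \<le> (\<delta> * b k powr (p / (p - 1)) + m k z) * G k z"
          using young_min[of "v z" "b k" p \<delta>] v0 b p \<delta> G unfolding m_def
          by (auto intro: mult_right_mono)
        also have "\<dots> = \<delta> * b k powr (p / (p - 1)) * G k z + m k z * G k z"
          by (simp add: algebra_simps)
        also have "\<dots> \<le> \<delta> * b k powr (p / (p - 1)) * G k z + m k z"
          using G v0 b by (intro add_left_mono mult_left_le) (auto simp: m_def)
        finally show "w k z \<le> \<delta> * b k powr (p / (p - 1)) * G k z + m k z" .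
      qed
      also have "\<dots> = (\<integral>z. \<delta> * b k powr (p / (p - 1)) * G k z \<partial>M) + (\<integral>z. m k z \<partial>M)"
        by (intro Bochner_Integration.integral_add integrable_mult_right G m_int)
      finally show ?thesis
        using eq[of k] \<delta>C[OF \<delta>, of k] I'0[of k] unfolding I'_def by linarith
    qed
    moreover have "(\<lambda>k. \<delta> * C + (\<integral>z. m k z \<partial>M)) \<longlonglongrightarrow> \<delta> * C + (\<integral>z. 0 \<partial>M)"
      by (intro tendsto_intros m0)
    ultimately show ?thesis
      using LIMSEQ_le[OF D] by auto
  qed
  note * = this
  show "D0 \<le> 0"
  proof (rule ccontr)
    assume "\<not> D0 \<le> 0"
    then have D0: "0 < D0" by simp
    \<comment> \<open>Using \<open>\<bar>C\<bar> + 1\<close> avoids any case distinction on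
      \<open>C\<close> and still gives \<open>\<delta> * C \<le> D0 / 2\<close>.\<close>
    define \<delta> where "\<delta> = D0 / (2 * (\<bar>C\<bar> + 1))"
    have \<delta>: "0 < \<delta>" using D0 by (simp add: \<delta>_def add_nonneg_pos)
    have "\<delta> * C \<le> \<delta> * (\<bar>C\<bar> + 1)" using \<delta> by (intro mult_left_mono) auto
    also have "\<dots> = D0 / 2" by (simp add: \<delta>_def field_simps add_nonneg_eq_0_iff)
    finally show False using *[OF \<delta>] D0 by simp
  qed
qed

section \<open>Scaling estimates for the test functions\<close>

lemma dt_test_fun:
  assumes "smooth_fun \<psi>"
  shows "dt k (test_fun s R (\<lambda>t. \<psi> (t * d))) t (x::'a::euclidean_space)
    = jbr (x /\<^sub>R R) powr (- (real DIM('a) + 2 * s)) * (d ^ k * (deriv ^^ k) \<psi> (t * d))"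
  unfolding dt_def test_fun_def higher_deriv_scaled(1)[OF assms] ..

lemma jbr_powr_le_1: "0 \<le> a \<Longrightarrow> jbr x powr (- a) \<le> 1"
  by (simp add: jbr_def powr_minus inverse_le_1_iff ge_one_powr_ge_zero)

text \<open>With \<open>d = R powr (- (2 * \<sigma> / 3))\<close>, a time derivative costs
  \<open>d\<close> and the operators with \<alpha> = 1/3, 2/3, 1 cost \<open>d\<close>,
  \<open>d^2\<close>, \<open>d^3\<close>, so all terms of the adjoint operator are of size
  \<open>d^3\<close>. In the data term, everything except the contribution of \<open>u2\<close>
  carries at least one factor \<open>d\<close>.\<close>

lemma test_fun_estimates:
  fixes \<sigma> \<eta> p s :: real
  assumes \<sigma>: "0 < \<sigma>" and \<eta>: "0 < \<eta>" and s: "0 < s" "s < \<sigma> / 3" and p: "1 < p"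
  shows "\<exists>\<psi> K. smooth_fun \<psi> \<and> \<psi> 0 = 1 \<and> (\<forall>t. 0 \<le> \<psi> t) \<and> (\<forall>t\<ge>0. \<psi> t \<le> 1) \<and> (\<forall>t\<ge>1. \<psi> t = 0) \<and>
    0 < K \<and> (\<forall>R\<ge>1.
      (\<forall>t. \<forall>x::'a::euclidean_space. \<bar>adj_op \<sigma> \<eta> (test_fun s R (\<lambda>t. \<psi> (t * R powr (- (2 * \<sigma> / 3))))) t x\<bar>
        \<le> K * R powr (- (2 * \<sigma>)) *
          (jbr (x /\<^sub>R R) powr (- (real DIM('a) + 2 * s)) * \<psi> (t * R powr (- (2 * \<sigma> / 3))) powr (1 / p))) \<and>
      (\<forall>u0 u1 u2. \<forall>x::'a.
        \<bar>data_term \<sigma> \<eta> u0 u1 u2 (test_fun s R (\<lambda>t. \<psi> (t * R powr (- (2 * \<sigma> / 3))))) x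
          - u2 x * jbr (x /\<^sub>R R) powr (- (real DIM('a) + 2 * s))\<bar>
        \<le> K * R powr (- (2 * \<sigma> / 3)) * (\<bar>u0 x\<bar> + \<bar>u1 x\<bar>)))"
proof -
  obtain \<psi> C where \<psi>: "smooth_fun \<psi>" "\<psi> 0 = 1" "\<And>t. 0 \<le> \<psi> t" "\<And>t. 0 \<le> t \<Longrightarrow> \<psi> t \<le> 1" "\<And>t. 1 \<le> t \<Longrightarrow> \<psi> t = 0"
    and C: "0 < C" "\<And>k t. k \<le> 3 \<Longrightarrow> \<bar>(deriv ^^ k) \<psi> t\<bar> \<le> C * \<psi> t powr (1 / p)"
    using cutoff_exists[OF p] by blast
  define \<phi> where "\<phi> R x = jbr (x /\<^sub>R R) powr (- (real DIM('a) + 2 * s))" for R and x :: 'a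
  have \<phi>: "0 \<le> \<phi> R x" "\<phi> R x \<le> 1" for R x
  proof -
    show "\<phi> R x \<le> 1" unfolding \<phi>_def by (rule jbr_powr_le_1) (use s in simp)
  qed (simp add: \<phi>_def)
  \<comment> \<open>The lowest power \<alpha> = 1/3 dictates the restriction
    \<open>s < \<sigma> / 3\<close>, which gives \<open>s < \<sigma> * \<alpha>\<close> for all
    three operators.\<close>
  have A: "\<exists>C>0. \<forall>R>0. \<forall>c. \<forall>x::'a. \<bar>fracA \<sigma> \<alpha> (\<lambda>y. \<phi> R y * c) x\<bar>
     \<le> \<bar>c\<bar> * (C * R powr (- (2 * (\<sigma> * \<alpha>))) * \<phi> R x)" if "1 / 3 \<le> \<alpha>" for \<alpha>
    unfolding \<phi>_def
    by (rule fracA_jbr_bound) (use s mult_left_mono[OF that less_imp_le[OF \<sigma>]] in linarith)+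
  obtain A1 where A1: "0 < A1" "\<And>R c x. 0 < R \<Longrightarrow> \<bar>fracA \<sigma> (1 / 3) (\<lambda>y. \<phi> R y * c) x\<bar>
     \<le> \<bar>c\<bar> * (A1 * R powr (- (2 * (\<sigma> * (1 / 3)))) * \<phi> R x)"
    using A[of "1 / 3"] by auto
  obtain A2 where A2: "0 < A2" "\<And>R c x. 0 < R \<Longrightarrow> \<bar>fracA \<sigma> (2 / 3) (\<lambda>y. \<phi> R y * c) x\<bar>
     \<le> \<bar>c\<bar> * (A2 * R powr (- (2 * (\<sigma> * (2 / 3)))) * \<phi> R x)"
    using A[of "2 / 3"] by auto
  obtain A3 where A3: "0 < A3" "\<And>R c x. 0 < R \<Longrightarrow> \<bar>fracA \<sigma> 1 (\<lambda>y. \<phi> R y * c) x\<bar>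
     \<le> \<bar>c\<bar> * (A3 * R powr (- (2 * (\<sigma> * 1))) * \<phi> R x)"
    using A[of 1] by auto
  define K where "K = C * (1 + A3 + \<eta> * A1 + \<eta> * A2)"
  have K: "0 < K" using C A1 A2 A3 \<eta> by (simp add: K_def add_pos_pos)
  have "\<bar>adj_op \<sigma> \<eta> (test_fun s R (\<lambda>t. \<psi> (t * R powr (- (2 * \<sigma> / 3))))) t x\<bar>
        \<le> K * R powr (- (2 * \<sigma>)) * (\<phi> R x * \<psi> (t * R powr (- (2 * \<sigma> / 3))) powr (1 / p))" (is ?adj)
    and "\<bar>data_term \<sigma> \<eta> u0 u1 u2 (test_fun s R (\<lambda>t. \<psi> (t * R powr (- (2 * \<sigma> / 3))))) x
          - u2 x * \<phi> R x\<bar> \<le> K * R powr (- (2 * \<sigma> / 3)) * (\<bar>u0 x\<bar> + \<bar>u1 x\<bar>)" (is ?data)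
    if R: "1 \<le> R" for R t x u0 u1 u2
  proof -
    define d where "d = R powr (- (2 * \<sigma> / 3))"
    define \<Phi> where "\<Phi> = (test_fun s R (\<lambda>t. \<psi> (t * d)) :: real \<Rightarrow> 'a \<Rightarrow> real)"
    have R0: "0 < R" using R by simp
    have d: "0 < d" using R0 by (simp add: d_def)
    have d1: "d \<le> 1"
      using R \<sigma> by (simp add: d_def powr_minus inverse_le_1_iff ge_one_powr_ge_zero)
    have Rd: "R powr (- (2 * (\<sigma> * (1 / 3)))) = d" "R powr (- (2 * (\<sigma> * (2 / 3)))) = d ^ 2"
        "R powr (- (2 * (\<sigma> * 1))) = d ^ 3"
      using R0 by (simp_all add: d_def powr_power)
    have \<Phi>: "\<Phi> t y = \<phi> R y * \<psi> (t * d)" for t y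
      by (simp add: \<Phi>_def test_fun_def \<phi>_def)
    have dt: "dt k \<Phi> t y = \<phi> R y * (d ^ k * (deriv ^^ k) \<psi> (t * d))" for k t y
      unfolding \<Phi>_def dt_test_fun[OF \<psi>(1)] \<phi>_def ..
    have dt_le: "\<bar>d ^ k * (deriv ^^ k) \<psi> (t * d)\<bar> \<le> d ^ k * (C * \<psi> (t * d) powr (1 / p))"
      if "k \<le> 3" for k t
      using d C(2)[OF that] by (simp add: abs_mult)
    have \<psi>_le: "\<bar>\<psi> (t * d)\<bar> \<le> C * \<psi> (t * d) powr (1 / p)" for t
      using C(2)[of 0] by simp
    define P where "P t = \<phi> R x * (C * \<psi> (t * d) powr (1 / p))" for t
    have P: "0 \<le> P t" for t using \<phi> C by (simp add: P_def)
    have B3: "\<bar>dt k \<Phi> t x\<bar> \<le> d ^ k * P t" if "k \<le> 3" for k t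
      unfolding dt P_def using mult_left_mono[OF dt_le[OF that, of t] \<phi>(1)[of R x]] \<phi>(1)[of R x]
      by (simp add: abs_mult mult_ac)
    have Ax0: "\<bar>Ax \<sigma> \<alpha> \<Phi> t x\<bar> \<le> A * D * P t"
      if "\<And>c. \<bar>fracA \<sigma> \<alpha> (\<lambda>y. \<phi> R y * c) x\<bar> \<le> \<bar>c\<bar> * (A * D * \<phi> R x)" "0 < A" "0 \<le> D" for \<alpha> t A D
    proof -
      have "\<bar>Ax \<sigma> \<alpha> \<Phi> t x\<bar> \<le> \<bar>\<psi> (t * d)\<bar> * (A * D * \<phi> R x)"
        unfolding Ax_def \<Phi> by (rule that)
      also have "\<dots> \<le> (C * \<psi> (t * d) powr (1 / p)) * (A * D * \<phi> R x)"
        using that \<phi> by (intro mult_right_mono \<psi>_le) auto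
      finally show ?thesis by (simp add: P_def mult_ac)
    qed
    have Axk: "\<bar>Ax \<sigma> \<alpha> (dt k \<Phi>) t x\<bar> \<le> A * D * (d ^ k * P t)"
      if "\<And>c. \<bar>fracA \<sigma> \<alpha> (\<lambda>y. \<phi> R y * c) x\<bar> \<le> \<bar>c\<bar> * (A * D * \<phi> R x)" "0 < A" "0 \<le> D" "k \<le> 3" for \<alpha> k t A D
    proof -
      have "\<bar>Ax \<sigma> \<alpha> (dt k \<Phi>) t x\<bar> \<le> \<bar>d ^ k * (deriv ^^ k) \<psi> (t * d)\<bar> * (A * D * \<phi> R x)"
        unfolding Ax_def dt by (rule that)
      also have "\<dots> \<le> (d ^ k * (C * \<psi> (t * d) powr (1 / p))) * (A * D * \<phi> R x)"
        using that \<phi> by (intro mult_right_mono dt_le) auto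
      finally show ?thesis by (simp add: P_def mult_ac)
    qed
    note F1 = A1(2)[OF R0, unfolded Rd] and F2 = A2(2)[OF R0, unfolded Rd] and F3 = A3(2)[OF R0, unfolded Rd]
    have "\<bar>adj_op \<sigma> \<eta> \<Phi> t x\<bar> \<le> \<bar>dt 3 \<Phi> t x\<bar> + \<bar>Ax \<sigma> 1 \<Phi> t x\<bar>
        + \<eta> * \<bar>Ax \<sigma> (1/3) (dt 2 \<Phi>) t x\<bar> + \<eta> * \<bar>Ax \<sigma> (2/3) (dt 1 \<Phi>) t x\<bar>"
    proof -
      have "\<eta> * \<bar>Ax \<sigma> (1/3) (dt 2 \<Phi>) t x\<bar> = \<bar>\<eta> * Ax \<sigma> (1/3) (dt 2 \<Phi>) t x\<bar>"
        "\<eta> * \<bar>Ax \<sigma> (2/3) (dt 1 \<Phi>) t x\<bar> = \<bar>\<eta> * Ax \<sigma> (2/3) (dt 1 \<Phi>) t x\<bar>"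
        using \<eta> by (simp_all add: abs_mult)
      then show ?thesis unfolding adj_op_def by linarith
    qed
    also have "\<dots> \<le> d ^ 3 * P t + A3 * d ^ 3 * P t + \<eta> * (A1 * d * (d ^ 2 * P t)) + \<eta> * (A2 * d ^ 2 * (d ^ 1 * P t))"
      using \<eta> d A1(1) A2(1) A3(1)
      by (intro add_mono mult_left_mono B3 Ax0[OF F3] Axk[OF F1] Axk[OF F2]) auto
    also have "\<dots> = K * d ^ 3 * (\<phi> R x * \<psi> (t * d) powr (1 / p))"
      by (simp add: K_def P_def algebra_simps power2_eq_square power3_eq_cube)
    finally show ?adj using Rd(3) by (simp add: \<Phi>_def d_def)

    have P0: "P 0 \<le> C" "0 \<le> P 0" using \<phi>(2)[of R x] P[of 0] C by (auto simp: P_def \<psi>)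
    \<comment> \<open>From \<open>R \<ge> 1\<close> it follows that \<open>d \<le> 1\<close>, so the
      quadratic contributions are also bounded by multiples of \<open>d\<close>.\<close>
    have d2: "d ^ 2 \<le> d" using d d1 by (simp add: power2_eq_square mult_left_le)
    have dP: "d * P 0 \<le> d * C" "d ^ 2 * P 0 \<le> d * C"
      using P0 d d2 by (auto intro: mult_mono)
    let ?e1 = "dt 1 \<Phi> 0 x" and ?e2 = "dt 2 \<Phi> 0 x" and ?e3 = "Ax \<sigma> (1/3) \<Phi> 0 x"
      and ?e4 = "Ax \<sigma> (1/3) (dt 1 \<Phi>) 0 x" and ?e5 = "Ax \<sigma> (2/3) \<Phi> 0 x"
    have e1: "\<bar>?e1\<bar> \<le> d * C" using B3[of 1 0] dP by simp
    have e2: "\<bar>?e2\<bar> \<le> d * C" using B3[of 2 0] dP by simp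
    note d' = less_imp_le[OF d] and A1' = less_imp_le[OF A1(1)] and A2' = less_imp_le[OF A2(1)]
    have e3: "\<bar>?e3\<bar> \<le> A1 * (d * C)"
      using Ax0[OF F1 A1(1) d', of 0] mult_left_mono[OF dP(1) A1'] by (simp only: mult.assoc)
    have e4: "\<bar>?e4\<bar> \<le> A1 * (d * C)"
      using Axk[OF F1 A1(1) d' one_le_numeral, of 0] mult_left_mono[OF dP(2) A1']
      by (simp only: mult.assoc power2_eq_square power_one_right)
    have e5: "\<bar>?e5\<bar> \<le> A2 * (d * C)"
      using Ax0[OF F2 A2(1) zero_le_power[OF d'], of 0] mult_left_mono[OF dP(2) A2'] by (simp only: mult.assoc)
    \<comment> \<open>As \<open>\<psi> 0 = 1\<close>, the contribution of \<open>u2\<close> cancels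
      exactly.\<close>
    have "data_term \<sigma> \<eta> u0 u1 u2 \<Phi> x - u2 x * \<phi> R x
        = u1 x * (\<eta> * ?e3 - ?e1) + u0 x * (?e2 - \<eta> * ?e4 + \<eta> * ?e5)"
      by (simp add: data_term_def \<Phi> \<psi>(2) algebra_simps)
    then have "\<bar>data_term \<sigma> \<eta> u0 u1 u2 \<Phi> x - u2 x * \<phi> R x\<bar>
        \<le> \<bar>u1 x\<bar> * \<bar>\<eta> * ?e3 - ?e1\<bar> + \<bar>u0 x\<bar> * \<bar>?e2 - \<eta> * ?e4 + \<eta> * ?e5\<bar>"
      by (simp add: abs_mult[symmetric] abs_triangle_ineq)
    also have "\<dots> \<le> \<bar>u1 x\<bar> * (K * d) + \<bar>u0 x\<bar> * (K * d)"
    proof (intro add_mono mult_left_mono)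
      have a: "\<bar>\<eta> * ?e3\<bar> \<le> \<eta> * (A1 * (d * C))" "\<bar>\<eta> * ?e4\<bar> \<le> \<eta> * (A1 * (d * C))"
          "\<bar>\<eta> * ?e5\<bar> \<le> \<eta> * (A2 * (d * C))"
        using \<eta> e3 e4 e5 by (auto simp: abs_mult)
      have Kd: "K * d = d * C + A3 * (d * C) + \<eta> * (A1 * (d * C)) + \<eta> * (A2 * (d * C))"
        by (simp add: K_def algebra_simps)
      have nn: "0 \<le> A3 * (d * C)" "0 \<le> \<eta> * (A1 * (d * C))" "0 \<le> \<eta> * (A2 * (d * C))"
        using A1(1) A2(1) A3(1) \<eta> C(1) d by auto
      show "\<bar>\<eta> * ?e3 - ?e1\<bar> \<le> K * d" using a e1 Kd nn by linarith
      show "\<bar>?e2 - \<eta> * ?e4 + \<eta> * ?e5\<bar> \<le> K * d" using a e2 Kd nn by linarith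
    qed auto
    finally show ?data by (simp add: \<Phi>_def d_def algebra_simps)
  qed
  then show ?thesis
    using \<psi> K unfolding \<phi>_def by (intro exI[of _ \<psi>] exI[of _ K]) auto
qed

section \<open>The critical exponent, measurability and limits\<close>

text \<open>The exponent of \<open>R\<close> is made up of the adjoint bound raised to the conjugate
  power \<open>p / (p - 1)\<close>, the length \<open>R^(2\<sigma>/3)\<close> of the time interval
  and the spatial mass \<open>R^n\<close>. After multiplication by \<open>p - 1\<close> the claim
  becomes \<open>(p - 1) (3n - 4\<sigma>) \<le> 6\<sigma>\<close>, which is the condition on
  \<open>p\<close>, and which is trivial if \<open>3n \<le> 4\<sigma>\<close>.\<close>

lemma p_crit_exponent:
  assumes \<sigma>: "0 < \<sigma>" and p: "1 < p" "ereal p \<le> p_crit n \<sigma>"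
  shows "- (2 * \<sigma>) * (p / (p - 1)) + 2 * \<sigma> / 3 + n \<le> 0"
proof -
  have "(p - 1) * (3 * n - 4 * \<sigma>) \<le> 6 * \<sigma>"
  proof (cases "3 * real n - 4 * \<sigma> \<le> 0")
    case True
    then have "(p - 1) * (3 * n - 4 * \<sigma>) \<le> 0" using p by (intro mult_nonneg_nonpos) auto
    then show ?thesis using \<sigma> by linarith
  next
    case False
    then have "p - 1 \<le> 6 * \<sigma> / (3 * real n - 4 * \<sigma>)"
      using p(2) by (simp add: p_crit_def)
    then show ?thesis using False by (simp add: pos_le_divide_eq)
  qed
  moreover have "(2 * \<sigma> / 3 + n) * (p - 1) = (p - 1) * (3 * n - 4 * \<sigma>) / 3 + 2 * \<sigma> * p - 2 * \<sigma>"
    by (simp add: field_simps)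
  ultimately have "(2 * \<sigma> / 3 + n) * (p - 1) \<le> 2 * \<sigma> * p" by linarith
  then have "2 * \<sigma> / 3 + n \<le> 2 * \<sigma> * p / (p - 1)" using p by (simp add: pos_le_divide_eq)
  then show ?thesis by simp
qed

text \<open>Local integrability provides measurability of the \<open>p\<close>-th power of the
  modulus on compact sets only. A \<open>p\<close>-th root recovers the modulus there, and the
  cylinders \<open>K m\<close> exhaust the slab.\<close>

lemma Lp_loc_measurable:
  fixes u :: "real \<Rightarrow> 'a::euclidean_space \<Rightarrow> real"
  assumes "Lp_loc p \<infinity> u" "0 < p"
  shows "(\<lambda>z. indicator (time_slab \<infinity>) z * \<bar>u (fst z) (snd z)\<bar>) \<in> borel_measurable lborel"
proof -
  define K where "K m = {0..real m} \<times> cball (0::'a) m" for m :: nat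
  have K: "compact (K m)" "K m \<subseteq> time_slab \<infinity>" for m
    unfolding K_def by (auto intro: compact_Times simp: time_slab_def)
  have meas: "(\<lambda>z. indicator (K m) z * \<bar>u (fst z) (snd z)\<bar>) \<in> borel_measurable lborel" for m
  proof -
    have "integrable lborel (\<lambda>z. indicator (K m) z *\<^sub>R (case z of (t, x) \<Rightarrow> \<bar>u t x\<bar> powr p))"
      using assms(1) K[of m] unfolding Lp_loc_def set_integrable_def by blast
    then have [measurable]: "(\<lambda>z. indicator (K m) z *\<^sub>R (case z of (t, x) \<Rightarrow> \<bar>u t x\<bar> powr p)) \<in> borel_measurable lborel"
      by (rule borel_measurable_integrable)
    have "(\<lambda>z. (indicator (K m) z *\<^sub>R (case z of (t, x) \<Rightarrow> \<bar>u t x\<bar> powr p)) powr (1 / p)) \<in> borel_measurable lborel"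
      by measurable
    also have "(\<lambda>z. (indicator (K m) z *\<^sub>R (case z of (t, x) \<Rightarrow> \<bar>u t x\<bar> powr p)) powr (1 / p))
        = (\<lambda>z. indicator (K m) z * \<bar>u (fst z) (snd z)\<bar>)"
      using assms(2) by (auto simp: fun_eq_iff indicator_def powr_powr)
    finally show ?thesis .
  qed
  show ?thesis
  proof (rule borel_measurable_LIMSEQ_real[OF _ meas])
    fix z :: "real \<times> 'a"
    obtain m :: nat where m: "\<bar>fst z\<bar> + norm (snd z) \<le> m" using real_arch_simple by blast
    have "indicator (K j) z = (indicator (time_slab \<infinity>) z :: real)" if "m \<le> j" for j
    proof -
      have "\<bar>fst z\<bar> \<le> real j" "norm (snd z) \<le> real j"
        using m of_nat_mono[OF that, where ?'a = real] norm_ge_zero[of "snd z"] by linarith+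
      then show ?thesis
        by (cases z) (auto simp: K_def time_slab_def indicator_def)
    qed
    then have "\<forall>\<^sub>F j in sequentially. indicator (K j) z * \<bar>u (fst z) (snd z)\<bar>
        = indicator (time_slab \<infinity>) z * \<bar>u (fst z) (snd z)\<bar>"
      unfolding eventually_sequentially by (intro exI[of _ m]) simp
    then show "(\<lambda>j. indicator (K j) z * \<bar>u (fst z) (snd z)\<bar>)
        \<longlonglongrightarrow> indicator (time_slab \<infinity>) z * \<bar>u (fst z) (snd z)\<bar>"
      by (rule tendsto_eventually)
  qed
qed

lemma integrable_product:
  fixes f :: "'a::euclidean_space \<Rightarrow> real" and g :: "'b::euclidean_space \<Rightarrow> real"
  assumes f: "integrable lborel f" and g: "integrable lborel g"
  shows "integrable lborel (\<lambda>z. f (fst z) * g (snd z))"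
    and "(\<integral>z. f (fst z) * g (snd z) \<partial>lborel) = (\<integral>x. f x \<partial>lborel) * (\<integral>y. g y \<partial>lborel)"
proof -
  have [measurable]: "f \<in> borel_measurable borel" "g \<in> borel_measurable borel"
    using f g by (auto dest: borel_measurable_integrable)
  have int: "integrable (lborel \<Otimes>\<^sub>M lborel) (\<lambda>z. f (fst z) * g (snd z))"
    by (rule lborel_pair.Fubini_integrable) (use f g in \<open>auto simp: abs_mult\<close>)
  then show "integrable lborel (\<lambda>z. f (fst z) * g (snd z))"
    by (simp add: lborel_prod)
  show "(\<integral>z. f (fst z) * g (snd z) \<partial>lborel) = (\<integral>x. f x \<partial>lborel) * (\<integral>y. g y \<partial>lborel)"
    using lborel_pair.integral_fst'[OF int] by (simp add: lborel_prod)
qed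

lemma tendsto_jbr_powr:
  fixes x :: "'a::euclidean_space"
  shows "(\<lambda>k. jbr (x /\<^sub>R real (Suc k)) powr a) \<longlonglongrightarrow> 1"
proof -
  have "(\<lambda>k. inverse (real (Suc k)) *\<^sub>R x) \<longlonglongrightarrow> 0 *\<^sub>R x"
    by (intro tendsto_intros LIMSEQ_inverse_real_of_nat)
  then have "(\<lambda>k. jbr (x /\<^sub>R real (Suc k)) powr a) \<longlonglongrightarrow> sqrt (1 + (norm (0 *\<^sub>R x))\<^sup>2) powr a"
    unfolding jbr_def
    by (intro tendsto_powr tendsto_real_sqrt tendsto_add tendsto_const tendsto_power tendsto_norm) auto
  then show ?thesis by simp
qed

lemma tendsto_Suc_powr_neg: "0 < a \<Longrightarrow> (\<lambda>k. real (Suc k) powr (- a)) \<longlonglongrightarrow> 0"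
  by (rule tendsto_neg_powr[OF _ filterlim_compose[OF filterlim_real_sequentially filterlim_Suc]]) simp

theorem theorem2p2:
  fixes \<sigma> \<eta> p :: real and u0 u1 u2 :: "'a::euclidean_space \<Rightarrow> real"
  assumes "0 < \<sigma>" and "1 < \<eta>"
    and "integrable lborel u0" and "integrable lborel u1" and "integrable lborel u2"
    and "(\<integral>x. u2 x \<partial>lborel) > 0"
    and "1 < p" and "ereal p \<le> p_crit DIM('a) \<sigma>"
  shows "\<forall>\<epsilon>>0. \<not> (\<exists>u. weak_solution \<sigma> \<eta> p \<epsilon> u0 u1 u2 \<infinity> u)"
proof (intro allI impI notI, elim exE)
  fix \<epsilon> :: real and u assume \<epsilon>: "0 < \<epsilon>" and ws: "weak_solution \<sigma> \<eta> p \<epsilon> u0 u1 u2 \<infinity> u"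
  obtain s0 where s0: "0 < s0" and weak: "\<And>s R \<zeta>. 0 < s \<and> s < s0 \<and> 0 < R \<and> admissible_time \<infinity> \<zeta> \<Longrightarrow>
        (let \<Phi> = test_fun s R \<zeta> in
           set_integrable lborel (time_slab \<infinity>) (\<lambda>(t, x). \<bar>u t x\<bar> powr p * \<Phi> t x) \<and>
           set_integrable lborel (time_slab \<infinity>) (\<lambda>(t, x). u t x * adj_op \<sigma> \<eta> \<Phi> t x) \<and>
           integrable lborel (data_term \<sigma> \<eta> u0 u1 u2 \<Phi>) \<and>
           set_lebesgue_integral lborel (time_slab \<infinity>) (\<lambda>(t, x). \<bar>u t x\<bar> powr p * \<Phi> t x)
             + \<epsilon> * (\<integral>x. data_term \<sigma> \<eta> u0 u1 u2 \<Phi> x \<partial>lborel)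
           = set_lebesgue_integral lborel (time_slab \<infinity>) (\<lambda>(t, x). u t x * adj_op \<sigma> \<eta> \<Phi> t x))"
    using ws unfolding weak_solution_def by blast
  \<comment> \<open>Small enough both for the weak identity (\<open>s < s0\<close>) and for the test
    function estimates (\<open>s < \<sigma> / 3\<close>).\<close>
  define s where "s = min (s0 / 2) (\<sigma> / 6)"
  have s: "0 < s" "s < s0" "s < \<sigma> / 3" using s0 assms(1) by (auto simp: s_def)
  define q where "q = real DIM('a) + 2 * s"
  have q: "0 \<le> q" using s by (simp add: q_def)
  obtain \<psi> K where \<psi>: "smooth_fun \<psi>" "\<psi> 0 = 1" "\<And>t. 0 \<le> \<psi> t" "\<And>t. 0 \<le> t \<Longrightarrow> \<psi> t \<le> 1" "\<And>t. 1 \<le> t \<Longrightarrow> \<psi> t = 0"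
    and K: "0 < K"
    and est: "\<forall>R\<ge>1.
      (\<forall>t. \<forall>x::'a. \<bar>adj_op \<sigma> \<eta> (test_fun s R (\<lambda>t. \<psi> (t * R powr (- (2 * \<sigma> / 3))))) t x\<bar>
        \<le> K * R powr (- (2 * \<sigma>)) *
          (jbr (x /\<^sub>R R) powr (- q) * \<psi> (t * R powr (- (2 * \<sigma> / 3))) powr (1 / p))) \<and>
      (\<forall>u0 u1 u2. \<forall>x::'a.
        \<bar>data_term \<sigma> \<eta> u0 u1 u2 (test_fun s R (\<lambda>t. \<psi> (t * R powr (- (2 * \<sigma> / 3))))) x
          - u2 x * jbr (x /\<^sub>R R) powr (- q)\<bar>
        \<le> K * R powr (- (2 * \<sigma> / 3)) * (\<bar>u0 x\<bar> + \<bar>u1 x\<bar>))"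
    using test_fun_estimates[of \<sigma> \<eta> s p, where ?'a = 'a] assms s unfolding q_def by auto
  \<comment> \<open>A sequence tending to infinity that respects the restriction
    \<open>R \<ge> 1\<close> of the estimates.\<close>
  define R where "R k = real (Suc k)" for k
  define d where "d k = R k powr (- (2 * \<sigma> / 3))" for k
  define \<phi> where "\<phi> k x = jbr (x /\<^sub>R R k) powr (- q)" for k and x :: 'a
  define \<Phi> where "\<Phi> k = (test_fun s (R k) (\<lambda>t. \<psi> (t * d k)) :: real \<Rightarrow> 'a \<Rightarrow> real)" for k
  have R: "1 \<le> R k" "0 < R k" for k by (auto simp: R_def)
  have d: "0 < d k" for k using R by (simp add: d_def R_def)
  have \<phi>: "0 \<le> \<phi> k x" "\<phi> k x \<le> 1" for k x
    unfolding \<phi>_def by (auto intro: jbr_powr_le_1 q)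
  have \<Phi>: "\<Phi> k t x = \<phi> k x * \<psi> (t * d k)" for k t x
    by (simp add: \<Phi>_def test_fun_def \<phi>_def q_def)
  have adj: "\<bar>adj_op \<sigma> \<eta> (\<Phi> k) t x\<bar> \<le> K * R k powr (- (2 * \<sigma>)) * (\<phi> k x * \<psi> (t * d k) powr (1 / p))" for k t x
    using est R(1)[of k] unfolding \<Phi>_def \<phi>_def d_def by blast
  have data: "\<bar>data_term \<sigma> \<eta> u0 u1 u2 (\<Phi> k) x - u2 x * \<phi> k x\<bar> \<le> K * d k * (\<bar>u0 x\<bar> + \<bar>u1 x\<bar>)" for k x
    using est R(1)[of k] unfolding \<Phi>_def \<phi>_def d_def by blast
  have adm: "admissible_time \<infinity> (\<lambda>t. \<psi> (t * d k))" for k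
    unfolding admissible_time_def
  proof (intro conjI exI[of _ "1 / d k"])
    show "smooth_fun (\<lambda>t. \<psi> (t * d k))" by (rule smooth_fun_scaled[OF \<psi>(1)])
    show "\<forall>t\<ge>1 / d k. \<psi> (t * d k) = 0" using d[of k] \<psi>(5) by (auto simp: field_simps)
  qed simp
  let ?S = "time_slab \<infinity> :: (real \<times> 'a) set"
  have int1: "set_integrable lborel ?S (\<lambda>(t, x). \<bar>u t x\<bar> powr p * \<Phi> k t x)"
    and int2: "set_integrable lborel ?S (\<lambda>(t, x). u t x * adj_op \<sigma> \<eta> (\<Phi> k) t x)"
    and int3: "integrable lborel (data_term \<sigma> \<eta> u0 u1 u2 (\<Phi> k))"
    and ident: "set_lebesgue_integral lborel ?S (\<lambda>(t, x). \<bar>u t x\<bar> powr p * \<Phi> k t x)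
             + \<epsilon> * (\<integral>x. data_term \<sigma> \<eta> u0 u1 u2 (\<Phi> k) x \<partial>lborel)
           = set_lebesgue_integral lborel ?S (\<lambda>(t, x). u t x * adj_op \<sigma> \<eta> (\<Phi> k) t x)" for k
    using weak[of s "R k" "\<lambda>t. \<psi> (t * d k)"] s R(2)[of k] adm[of k] unfolding \<Phi>_def Let_def by blast+

  \<comment> \<open>The indicator of the slab is built into \<open>v\<close>, so that the set
    integrals become integrals over the whole space. Below, \<theta> is the \<open>p\<close>-th root
    of the cutoff in time.\<close>
  define v where "v z = indicator ?S z * \<bar>u (fst z) (snd z)\<bar>" for z
  define \<theta> where "\<theta> k z = indicator ?S z * \<psi> (fst z * d k) powr (1 / p)" for k and z :: "real \<times> 'a"
  \<comment> \<open>The bracket is constant in time and not integrable over the slab. Cutting at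
    \<open>1 / d k\<close> makes it integrable and changes no product with the cutoff, which
    vanishes from there on.\<close>
  define G where "G k z = indicator {0..1 / d k} (fst z) * \<phi> k (snd z)" for k and z :: "real \<times> 'a"
  define b where "b k = K * R k powr (- (2 * \<sigma>))" for k
  define w where "w k z = \<bar>indicator ?S z *\<^sub>R (case z of (t, x) \<Rightarrow> u t x * adj_op \<sigma> \<eta> (\<Phi> k) t x)\<bar>" for k z
  define M where "M = pi powr (DIM('a) / 2) * (Gamma s / Gamma (DIM('a) / 2 + s))"
  define D where "D k = \<epsilon> * (\<integral>x. data_term \<sigma> \<eta> u0 u1 u2 (\<Phi> k) x \<partial>lborel)" for k
  have S_iff: "z \<in> ?S \<longleftrightarrow> 0 \<le> fst z" for z by (cases z) (simp add: time_slab_def)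
  have \<theta>p: "\<theta> k z powr p = indicator ?S z * \<psi> (fst z * d k)" for k z
    using assms(7) \<psi>(3) by (simp add: \<theta>_def indicator_def powr_powr)
  \<comment> \<open>Needed for the identity and for the \<open>p\<close>-th root in place of
    \<open>f\<close>; both vanish at 0, where the truncation in \<open>G\<close> acts.\<close>
  have G\<psi>: "G k z * (indicator ?S z * f (\<psi> (fst z * d k))) = indicator ?S z * (\<phi> k (snd z) * f (\<psi> (fst z * d k)))"
    if "f 0 = 0" for f :: "real \<Rightarrow> real" and k z
  proof (cases "z \<in> ?S \<and> 1 / d k < fst z")
    case True
    then have "\<psi> (fst z * d k) = 0" using d[of k] by (intro \<psi>(5)) (simp add: field_simps)
    then show ?thesis using that by simp
  next
    case False
    then show ?thesis by (auto simp: G_def S_iff indicator_def)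
  qed
  have V\<Phi>: "v z powr p * (G k z * \<theta> k z powr p) = indicator ?S z *\<^sub>R (case z of (t, x) \<Rightarrow> \<bar>u t x\<bar> powr p * \<Phi> k t x)"
    for k z
    unfolding \<theta>p using G\<psi>[of "\<lambda>y. y" k z] by (auto simp: v_def \<Phi> indicator_def split: prod.splits)
  have d0: "d \<longlonglongrightarrow> 0"
    unfolding d_def R_def using assms(1) by (intro tendsto_Suc_powr_neg) simp
  have \<phi>1: "(\<lambda>k. \<phi> k x) \<longlonglongrightarrow> 1" for x
    unfolding \<phi>_def R_def by (rule tendsto_jbr_powr)
  have \<phi>_int: "integrable lborel (\<phi> k)" and \<phi>_val: "(\<integral>x. \<phi> k x \<partial>lborel) = M * R k powr DIM('a)" for k
  proof -
    have "q = 2 * (DIM('a) / 2 + s)" by (simp add: q_def)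
    then show "integrable lborel (\<phi> k)"
      unfolding \<phi>_def[abs_def] using jbr_powr_fourier(1)[OF s(1) R(2)] by simp
    show "(\<integral>x. \<phi> k x \<partial>lborel) = M * R k powr DIM('a)"
      unfolding \<phi>_def q_def M_def by (rule integral_jbr_powr[OF s(1) R(2)])
  qed
  have ind_int: "integrable lborel (\<lambda>t::real. indicator {0..1 / d k} t :: real)"
    and ind_val: "(\<integral>t. indicator {0..1 / d k} t \<partial>lborel) = 1 / d k" for k
    using d[of k] by (auto simp: less_imp_le)
  \<comment> \<open>Dominated convergence: all contributions except that of \<open>u2\<close> are of
    order \<open>d k\<close>, and the bracket tends to 1.\<close>
  have D_lim: "D \<longlonglongrightarrow> \<epsilon> * (\<integral>x. u2 x \<partial>lborel)"
    unfolding D_def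
  proof (intro tendsto_intros integral_dominated_convergence)
    show "u2 \<in> borel_measurable lborel" "\<And>k. data_term \<sigma> \<eta> u0 u1 u2 (\<Phi> k) \<in> borel_measurable lborel"
      using assms(5) int3 by (auto dest: borel_measurable_integrable)
    show "integrable lborel (\<lambda>x. \<bar>u2 x\<bar> + K * (\<bar>u0 x\<bar> + \<bar>u1 x\<bar>))"
      using assms by auto
    show "AE x in lborel. (\<lambda>k. data_term \<sigma> \<eta> u0 u1 u2 (\<Phi> k) x) \<longlonglongrightarrow> u2 x"
    proof (intro AE_I2)
      fix x
      have "(\<lambda>k. K * d k * (\<bar>u0 x\<bar> + \<bar>u1 x\<bar>)) \<longlonglongrightarrow> 0"
        by (intro tendsto_mult_left_zero tendsto_mult_right_zero d0)
      then have "(\<lambda>k. data_term \<sigma> \<eta> u0 u1 u2 (\<Phi> k) x - u2 x * \<phi> k x) \<longlonglongrightarrow> 0"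
        by (rule Lim_null_comparison[rotated]) (simp add: data)
      moreover have "(\<lambda>k. u2 x * \<phi> k x) \<longlonglongrightarrow> u2 x * 1"
        by (intro tendsto_intros \<phi>1)
      ultimately show "(\<lambda>k. data_term \<sigma> \<eta> u0 u1 u2 (\<Phi> k) x) \<longlonglongrightarrow> u2 x"
        using tendsto_add by fastforce
    qed
    fix k
    show "AE x in lborel. norm (data_term \<sigma> \<eta> u0 u1 u2 (\<Phi> k) x) \<le> \<bar>u2 x\<bar> + K * (\<bar>u0 x\<bar> + \<bar>u1 x\<bar>)"
    proof (intro AE_I2)
      fix x
      have "d k \<le> 1"
        using R(1)[of k] assms(1) by (simp add: d_def powr_minus inverse_le_1_iff ge_one_powr_ge_zero)
      then have "K * d k * (\<bar>u0 x\<bar> + \<bar>u1 x\<bar>) \<le> K * 1 * (\<bar>u0 x\<bar> + \<bar>u1 x\<bar>)"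
        using K by (intro mult_right_mono mult_left_mono) auto
      moreover have "\<bar>u2 x * \<phi> k x\<bar> \<le> \<bar>u2 x\<bar>"
        using \<phi>[of k x] by (simp add: abs_mult mult_left_le)
      ultimately show "norm (data_term \<sigma> \<eta> u0 u1 u2 (\<Phi> k) x) \<le> \<bar>u2 x\<bar> + K * (\<bar>u0 x\<bar> + \<bar>u1 x\<bar>)"
        using data[of k x] unfolding real_norm_def mult_1_right by linarith
    qed
  qed

  have "\<epsilon> * (\<integral>x. u2 x \<partial>lborel) \<le> 0"
  proof (rule test_function_argument[where v = v and G = G and \<theta> = \<theta> and b = b and w = w and D = D
        and C = "K powr (p / (p - 1)) * M", OF assms(7)])
    show "v \<in> borel_measurable lborel"
      unfolding v_def[abs_def] using ws assms(7) by (intro Lp_loc_measurable) (auto simp: weak_solution_def)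
    show "integrable lborel (G k)" for k
      unfolding G_def[abs_def] by (rule integrable_product(1)[OF ind_int \<phi>_int])
    show "G k z \<le> 1" "0 \<le> G k z" for k z using \<phi> by (auto simp: G_def indicator_def)
    show "\<theta> k z \<le> 1" "0 \<le> \<theta> k z" for k z
    proof -
      show "\<theta> k z \<le> 1"
      proof (cases "z \<in> ?S")
        case True
        then have "\<psi> (fst z * d k) powr (1 / p) \<le> 1"
          using d[of k] assms(7) by (intro powr_le1) (auto simp: S_iff less_imp_le \<psi>(3) intro!: \<psi>(4))
        then show ?thesis using True by (simp add: \<theta>_def)
      qed (simp add: \<theta>_def)
    qed (simp add: \<theta>_def)
    show "0 \<le> b k" for k using K by (simp add: b_def)
    show "b \<longlonglongrightarrow> 0"
      unfolding b_def R_def using assms(1) by (intro tendsto_mult_right_zero tendsto_Suc_powr_neg) simp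
    show "b k powr (p / (p - 1)) * (\<integral>z. G k z \<partial>lborel) \<le> K powr (p / (p - 1)) * M" for k
    proof -
      \<comment> \<open>The time interval contributes \<open>1 / d k\<close> and the bracket
        \<open>M * R k powr DIM('a)\<close>. By \<open>p_crit_exponent\<close> the total power of
        \<open>R k \<ge> 1\<close> is nonpositive, with equality allowed in the critical
        case.\<close>
      have "(\<integral>z. G k z \<partial>lborel) = 1 / d k * (M * R k powr DIM('a))"
        unfolding G_def integrable_product(2)[OF ind_int \<phi>_int] ind_val \<phi>_val ..
      also have "1 / d k = R k powr (2 * \<sigma> / 3)" by (simp add: d_def powr_minus field_simps)
      finally have "b k powr (p / (p - 1)) * (\<integral>z. G k z \<partial>lborel)
          = K powr (p / (p - 1)) * M *
            (R k powr (- (2 * \<sigma>) * (p / (p - 1))) * R k powr (2 * \<sigma> / 3) * R k powr DIM('a))"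
        by (simp only: b_def powr_mult powr_powr mult_ac)
      also have "\<dots> = K powr (p / (p - 1)) * M * R k powr (- (2 * \<sigma>) * (p / (p - 1)) + 2 * \<sigma> / 3 + DIM('a))"
        by (simp only: powr_add)
      also have "\<dots> \<le> K powr (p / (p - 1)) * M * R k powr 0"
        using p_crit_exponent[OF assms(1,7,8)] R(1)[of k] s(1)
        by (intro mult_left_mono powr_mono) (auto simp: M_def less_imp_le[OF Gamma_real_pos] add_nonneg_pos)
      finally show ?thesis using R(2)[of k] by simp
    qed
    show "integrable lborel (\<lambda>z. v z powr p * (G k z * \<theta> k z powr p))" for k
      using int1[of k] unfolding V\<Phi> set_integrable_def .
    show "(\<lambda>k. v z powr p * (G k z * \<theta> k z powr p)) \<longlonglongrightarrow> v z powr p" for z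
    proof -
      have "isCont \<psi> 0"
        using \<psi>(1) unfolding smooth_fun_def by (auto intro!: differentiable_imp_continuous_within dest: spec[of _ "0::nat"])
      then have "(\<lambda>k. \<psi> (fst z * d k)) \<longlonglongrightarrow> \<psi> 0"
        by (rule isCont_tendsto_compose) (intro tendsto_mult_right_zero d0)
      then have "(\<lambda>k. v z powr p * (\<phi> k (snd z) * \<psi> (fst z * d k))) \<longlonglongrightarrow> v z powr p * (1 * \<psi> 0)"
        by (intro tendsto_intros \<phi>1)
      moreover have "v z powr p * (\<phi> k (snd z) * \<psi> (fst z * d k)) = v z powr p * (G k z * \<theta> k z powr p)" for k
        unfolding \<theta>p using G\<psi>[of "\<lambda>y. y" k z] by (auto simp: v_def indicator_def)
      ultimately show ?thesis using \<psi>(2) by simp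
    qed
    show "integrable lborel (w k)" for k
      unfolding w_def[abs_def] using int2[of k] unfolding set_integrable_def by (rule integrable_abs)
    show "w k z \<le> b k * v z * (G k z * \<theta> k z)" for k z
    proof (cases "z \<in> ?S")
      case True
      obtain t x where z: "z = (t, x)" by (cases z)
      have "w k z = \<bar>u t x\<bar> * \<bar>adj_op \<sigma> \<eta> (\<Phi> k) t x\<bar>" using True by (simp add: w_def z abs_mult)
      also have "\<dots> \<le> \<bar>u t x\<bar> * (b k * (\<phi> k x * \<psi> (t * d k) powr (1 / p)))"
        unfolding b_def by (intro mult_left_mono adj) simp
      also have "\<phi> k x * \<psi> (t * d k) powr (1 / p) = G k z * \<theta> k z"
        using G\<psi>[of "\<lambda>y. y powr (1 / p)" k z] True by (auto simp: \<theta>_def z)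
      finally show ?thesis using True by (simp add: v_def z mult_ac)
    qed (simp add: w_def v_def)
    \<comment> \<open>The right-hand side of the weak identity is estimated by the integral of its
      modulus, which is \<open>w k\<close>.\<close>
    show "(\<integral>z. v z powr p * (G k z * \<theta> k z powr p) \<partial>lborel) + D k \<le> (\<integral>z. w k z \<partial>lborel)" for k
      using ident[of k] integral_abs_bound[of lborel "\<lambda>z. indicator ?S z *\<^sub>R (case z of (t, x) \<Rightarrow> u t x * adj_op \<sigma> \<eta> (\<Phi> k) t x)"]
      unfolding V\<Phi> D_def w_def set_lebesgue_integral_def by linarith
  qed (use D_lim in \<open>auto simp: v_def\<close>)
  with \<epsilon> assms(6) show False by (simp add: mult_le_0_iff)
qed

end
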